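(* Let $(R,d,h)$ be a CDG-ring, let $\mathcal T$ be a class of objects in the abelian category $R\text{-}\mathrm{Mod}^{\mathrm{cdg}}$ of left CDG-modules over $(R,d,h)$, and let $\alpha$ be a countable ordinal. Then any object of $\mathrm{Fil}_\alpha(\mathcal T)\subset R\text{-}\mathrm{Mod}^{\mathrm{cdg}}$, viewed as an object of the homotopy category $\mathrm{Hot}(R\text{-}\mathrm{Mod}^{\mathrm{cdg}})$, belongs to the minimal full triangulated subcategory of $\mathrm{Hot}(R\text{-}\mathrm{Mod}^{\mathrm{cdg}})$ containing the CDG-modules from $\mathcal T$ and the totalizations of short exact sequences in $R\text{-}\mathrm{Mod}^{\mathrm{cdg}}$, and closed under countable direct sums.
   Context: A curved DG-ring (CDG-ring) $(R,d,h)$ is a graded associative unital ring $R=\bigoplus_{n\in\mathbb Z}R^n$ with additive maps $d\colon R^n\to R^{n+1}$ satisfying $d(rs)=d(r)s+(-1)^{|r|}rd(s)$ for homogeneous $r,s$, and an element $h\in R^2$ such that $d(d(r))=hr-rh$ for all $r\in R$ and $d(h)=0$. A left CDG-module $(M,d_M)$ over $(R,d,h)$ is a graded left $R$-module $M=\bigoplus_{n\in\mathbb Z}M^n$ with additive maps $d_M\colon M^n\to M^{n+1}$ satisfying $d_M(rm)=d(r)m+(-1)^{|r|}rd_M(m)$ for homogeneous $r,m$, and $d_M(d_M(m))=hm$ for all $m\in M$. The category $R\text{-}\mathrm{Mod}^{\mathrm{cdg}}$ has left CDG-modules as objects and homogeneous $R$-linear maps of degree $0$ commuting with the differentials as morphisms;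 it is abelian with infinite direct sums and products, and exactness is understood in this category. The shift $M[i]$ is given by $M[i]^n=M^{n+i}$, with $r\in R$ acting by $(-1)^{i|r|}r$ and $d_{M[i]}=(-1)^id_M$. For left CDG-modules $L,M$, $\operatorname{Hom}_R(L,M)$ is the complex of abelian groups whose degree-$i$ component is the group of degree-$0$ homomorphisms of graded left $R$-modules $L\to M[i]$, viewed as degree-$i$ maps $f\colon L\to M$, with differential $f\mapsto d_Mf-(-1)^ifd_L$. The homotopy category $\mathrm{Hot}(R\text{-}\mathrm{Mod}^{\mathrm{cdg}})$ has left CDG-modules as objects and $H^0(\operatorname{Hom}_R(L,M))$ as the groups of morphisms. It is a triangulated category with shift $[1]$ and distinguished triangles given by the cones: for a morphism $f\colon X\to Y$ in $R\text{-}\mathrm{Mod}^{\mathrm{cdg}}$, $\mathrm{cone}(f)=Y\oplus X[1]$ with differential $(y,x)\mapsto(d_Yy+f(x),-d_Xx)$. It has infinite direct sums and products, computed as in $R\text{-}\mathrm{Mod}^{\mathrm{cdg}}$. For morphisms $K\xrightarrow{i}L\xrightarrow{p}M$ in $R\text{-}\mathrm{Mod}^{\mathrm{cdg}}$ with $pi=0$, the totalization $\mathrm{Tot}(K\to L\to M)$ is the CDG-module obtained as the iterated cone, i.e. the cone of the morphism $\mathrm{cone}(i)\to M$ induced by $p$ (a shift convention is immaterial here, as triangulated subcategories are closed under shifts). The totalization of a short exact sequence $0\to K\to L\to M\to0$ is $\mathrm{Tot}(K\to L\to M)$. For an ordinal $\alpha$, an $\alpha$-filtration on an object $M$ is a family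 of subobjects $F_iM\subset M$, $0\le i\le\alpha$, with $F_0M=0$, $F_\alpha M=M$, $F_jM\subset F_iM$ for $j\le i$, and $F_iM=\bigcup_{j<i}F_jM$ for all limit ordinals $i\le\alpha$. $\mathrm{Fil}_\alpha(\mathcal T)$ is the class of all objects $M$ admitting an $\alpha$-filtration with $F_{i+1}M/F_iM$ isomorphic to an object from $\mathcal T$ for every $0\le i<\alpha$. *)

theory Defs
  imports "HOL-Algebra.Product_Groups" "HOL-Library.Countable_Set"
begin

(* Graded objects are represented by the families of their homogeneous components.  Each component
   is an abelian group in the sense of HOL-Algebra, whose notation is multiplicative: the sum of x
   and y is x \<otimes> y, zero is \<one>, and -x is inv x.  Only the values of the operations on the carriers
   matter; the notions below are insensitive to their values elsewhere. *)

text \<open>The element $(-1)^k x$ of the abelian group $G$.\<close>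

definition sgn_pow :: "'a monoid \<Rightarrow> int \<Rightarrow> 'a \<Rightarrow> 'a" where
  "sgn_pow G k x = (if even k then x else inv\<^bsub>G\<^esub> x)"


section \<open>CDG-rings and left CDG-modules\<close>

text \<open>\<open>rmul R m n\<close> is the multiplication of a component of degree \<open>m\<close> with one of degree \<open>n\<close>, and
  \<open>rdiff R n\<close> is the differential on the component of degree \<open>n\<close>.  The unit is not required to
  differ from zero.\<close>

record 'r cdg_ring =
  rcomp :: "int \<Rightarrow> 'r monoid"
  rmul :: "int \<Rightarrow> int \<Rightarrow> 'r \<Rightarrow> 'r \<Rightarrow> 'r"
  runit :: 'r
  rdiff :: "int \<Rightarrow> 'r \<Rightarrow> 'r"
  rcurv :: 'r

locale cdg_ring =
  fixes R :: "'r cdg_ring"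
  assumes rcomp_comm_group: "comm_group (rcomp R n)"
    and rmul_hom_left: "s \<in> carrier (rcomp R n) \<Longrightarrow>
          (\<lambda>r. rmul R m n r s) \<in> hom (rcomp R m) (rcomp R (m + n))"
    and rmul_hom_right: "r \<in> carrier (rcomp R m) \<Longrightarrow>
          (\<lambda>s. rmul R m n r s) \<in> hom (rcomp R n) (rcomp R (m + n))"
    and rmul_assoc: "\<lbrakk>r \<in> carrier (rcomp R m); s \<in> carrier (rcomp R n); t \<in> carrier (rcomp R k)\<rbrakk> \<Longrightarrow>
          rmul R (m + n) k (rmul R m n r s) t = rmul R m (n + k) r (rmul R n k s t)"
    and runit_closed: "runit R \<in> carrier (rcomp R 0)"
    and runit_left: "r \<in> carrier (rcomp R n) \<Longrightarrow> rmul R 0 n (runit R) r = r"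
    and runit_right: "r \<in> carrier (rcomp R n) \<Longrightarrow> rmul R n 0 r (runit R) = r"
    and rdiff_hom: "rdiff R n \<in> hom (rcomp R n) (rcomp R (n + 1))"
    and rdiff_Leibniz: "\<lbrakk>r \<in> carrier (rcomp R m); s \<in> carrier (rcomp R n)\<rbrakk> \<Longrightarrow>
          rdiff R (m + n) (rmul R m n r s) =
            rmul R (m + 1) n (rdiff R m r) s
              \<otimes>\<^bsub>rcomp R (m + n + 1)\<^esub>
            sgn_pow (rcomp R (m + n + 1)) m (rmul R m (n + 1) r (rdiff R n s))"
    and rcurv_closed: "rcurv R \<in> carrier (rcomp R 2)"
    and rdiff_rdiff: "r \<in> carrier (rcomp R n) \<Longrightarrow>
          rdiff R (n + 1) (rdiff R n r) =
            rmul R 2 n (rcurv R) r \<otimes>\<^bsub>rcomp R (n + 2)\<^esub> inv\<^bsub>rcomp R (n + 2)\<^esub> (rmul R n 2 r (rcurv R))"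
    and rdiff_rcurv: "rdiff R 2 (rcurv R) = \<one>\<^bsub>rcomp R 3\<^esub>"

text \<open>\<open>act M m n r x\<close> is the product of \<open>r\<close> of degree \<open>m\<close> and \<open>x\<close> of degree \<open>n\<close>.\<close>

record ('r, 'u) cdg_module =
  mcomp :: "int \<Rightarrow> 'u monoid"
  act :: "int \<Rightarrow> int \<Rightarrow> 'r \<Rightarrow> 'u \<Rightarrow> 'u"
  mdiff :: "int \<Rightarrow> 'u \<Rightarrow> 'u"

locale cdg_module = cdg_ring R
  for R :: "'r cdg_ring" and M :: "('r, 'u) cdg_module" +
  assumes mcomp_comm_group: "comm_group (mcomp M n)"
    and act_hom_left: "x \<in> carrier (mcomp M n) \<Longrightarrow>
          (\<lambda>r. act M m n r x) \<in> hom (rcomp R m) (mcomp M (m + n))"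
    and act_hom_right: "r \<in> carrier (rcomp R m) \<Longrightarrow>
          (\<lambda>x. act M m n r x) \<in> hom (mcomp M n) (mcomp M (m + n))"
    and act_assoc: "\<lbrakk>r \<in> carrier (rcomp R m); s \<in> carrier (rcomp R n); x \<in> carrier (mcomp M k)\<rbrakk> \<Longrightarrow>
          act M (m + n) k (rmul R m n r s) x = act M m (n + k) r (act M n k s x)"
    and act_unit: "x \<in> carrier (mcomp M n) \<Longrightarrow> act M 0 n (runit R) x = x"
    and mdiff_hom: "mdiff M n \<in> hom (mcomp M n) (mcomp M (n + 1))"
    and mdiff_Leibniz: "\<lbrakk>r \<in> carrier (rcomp R m); x \<in> carrier (mcomp M n)\<rbrakk> \<Longrightarrow>
          mdiff M (m + n) (act M m n r x) =
            act M (m + 1) n (rdiff R m r) x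
              \<otimes>\<^bsub>mcomp M (m + n + 1)\<^esub>
            sgn_pow (mcomp M (m + n + 1)) m (act M m (n + 1) r (mdiff M n x))"
    and mdiff_mdiff: "x \<in> carrier (mcomp M n) \<Longrightarrow>
          mdiff M (n + 1) (mdiff M n x) = act M 2 n (rcurv R) x"


section \<open>The abelian category of left CDG-modules\<close>

definition graded_hom ::
  "'r cdg_ring \<Rightarrow> ('r, 'a) cdg_module \<Rightarrow> ('r, 'b) cdg_module \<Rightarrow> (int \<Rightarrow> 'a \<Rightarrow> 'b) \<Rightarrow> bool" where
  "graded_hom R L M f \<longleftrightarrow>
     (\<forall>n. f n \<in> hom (mcomp L n) (mcomp M n)) \<and>
     (\<forall>m n. \<forall>r\<in>carrier (rcomp R m). \<forall>x\<in>carrier (mcomp L n).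
        f (m + n) (act L m n r x) = act M m n r (f n x))"

definition cdg_hom ::
  "'r cdg_ring \<Rightarrow> ('r, 'a) cdg_module \<Rightarrow> ('r, 'b) cdg_module \<Rightarrow> (int \<Rightarrow> 'a \<Rightarrow> 'b) \<Rightarrow> bool" where
  "cdg_hom R L M f \<longleftrightarrow>
     graded_hom R L M f \<and>
     (\<forall>n. \<forall>x\<in>carrier (mcomp L n). f (n + 1) (mdiff L n x) = mdiff M n (f n x))"

definition id_map :: "int \<Rightarrow> 'a \<Rightarrow> 'a" where
  "id_map n x = x"

definition comp_map :: "(int \<Rightarrow> 'b \<Rightarrow> 'c) \<Rightarrow> (int \<Rightarrow> 'a \<Rightarrow> 'b) \<Rightarrow> int \<Rightarrow> 'a \<Rightarrow> 'c" where
  "comp_map g f n x = g n (f n x)"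

definition cdg_isomorphic ::
  "'r cdg_ring \<Rightarrow> ('r, 'a) cdg_module \<Rightarrow> ('r, 'b) cdg_module \<Rightarrow> bool" where
  "cdg_isomorphic R L M \<longleftrightarrow>
     (\<exists>f. cdg_hom R L M f \<and> (\<forall>n. bij_betw (f n) (carrier (mcomp L n)) (carrier (mcomp M n))))"

definition cdg_short_exact ::
  "'r cdg_ring \<Rightarrow> ('r, 'a) cdg_module \<Rightarrow> ('r, 'b) cdg_module \<Rightarrow> ('r, 'c) cdg_module \<Rightarrow>
   (int \<Rightarrow> 'a \<Rightarrow> 'b) \<Rightarrow> (int \<Rightarrow> 'b \<Rightarrow> 'c) \<Rightarrow> bool" where
  "cdg_short_exact R K L M i p \<longleftrightarrow>
     cdg_module R K \<and> cdg_module R L \<and> cdg_module R M \<and> cdg_hom R K L i \<and> cdg_hom R L M p \<and>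
     (\<forall>n. inj_on (i n) (carrier (mcomp K n)) \<and>
          i n ` carrier (mcomp K n) = kernel (mcomp L n) (mcomp M n) (p n) \<and>
          p n ` carrier (mcomp L n) = carrier (mcomp M n))"

definition direct_sum :: "'i set \<Rightarrow> ('i \<Rightarrow> ('r, 'u) cdg_module) \<Rightarrow> ('r, 'i \<Rightarrow> 'u) cdg_module" where
  "direct_sum I X =
     \<lparr>mcomp = (\<lambda>n. sum_group I (\<lambda>i. mcomp (X i) n)),
      act = (\<lambda>m n r x. \<lambda>i\<in>I. act (X i) m n r (x i)),
      mdiff = (\<lambda>n x. \<lambda>i\<in>I. mdiff (X i) n (x i))\<rparr>"

text \<open>Subobjects are families of subsets of the components.\<close>

definition cdg_submodule ::
  "'r cdg_ring \<Rightarrow> (int \<Rightarrow> 'u set) \<Rightarrow> ('r, 'u) cdg_module \<Rightarrow> bool" where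
  "cdg_submodule R N M \<longleftrightarrow>
     (\<forall>n. subgroup (N n) (mcomp M n)) \<and>
     (\<forall>m n. \<forall>r\<in>carrier (rcomp R m). \<forall>x\<in>N n. act M m n r x \<in> N (m + n)) \<and>
     (\<forall>n. \<forall>x\<in>N n. mdiff M n x \<in> N (n + 1))"

definition restrict_module :: "('r, 'u) cdg_module \<Rightarrow> (int \<Rightarrow> 'u set) \<Rightarrow> ('r, 'u) cdg_module" where
  "restrict_module M N = M\<lparr>mcomp := \<lambda>n. (mcomp M n)\<lparr>carrier := N n\<rparr>\<rparr>"

text \<open>The operations of a quotient module send a coset to the coset of the images of its elements;
  for a coset \<open>C\<close>, all the cosets in each of the unions below are equal.\<close>

definition quotient_module :: "('r, 'u) cdg_module \<Rightarrow> (int \<Rightarrow> 'u set) \<Rightarrow> ('r, 'u set) cdg_module" where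
  "quotient_module M N =
     \<lparr>mcomp = (\<lambda>n. mcomp M n Mod N n),
      act = (\<lambda>m n r C. \<Union>x\<in>C. N (m + n) #>\<^bsub>mcomp M (m + n)\<^esub> act M m n r x),
      mdiff = (\<lambda>n C. \<Union>x\<in>C. N (n + 1) #>\<^bsub>mcomp M (n + 1)\<^esub> mdiff M n x)\<rparr>"


section \<open>Shifts, homotopies and the homotopy category\<close>

definition shift :: "int \<Rightarrow> ('r, 'u) cdg_module \<Rightarrow> ('r, 'u) cdg_module" where
  "shift i M =
     \<lparr>mcomp = (\<lambda>n. mcomp M (n + i)),
      act = (\<lambda>m n r x. sgn_pow (mcomp M (m + n + i)) (i * m) (act M m (n + i) r x)),
      mdiff = (\<lambda>n x. sgn_pow (mcomp M (n + 1 + i)) i (mdiff M (n + i) x))\<rparr>"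

definition shift_map :: "int \<Rightarrow> (int \<Rightarrow> 'a \<Rightarrow> 'b) \<Rightarrow> int \<Rightarrow> 'a \<Rightarrow> 'b" where
  "shift_map i f n = f (n + i)"

text \<open>Elements of degree \<open>i\<close> of the complex of homomorphisms from \<open>L\<close> to \<open>M\<close>, and the differential
  of that complex; \<open>f n\<close> maps the component of degree \<open>n\<close> of \<open>L\<close> to that of degree \<open>n + i\<close> of \<open>M\<close>.\<close>

definition hom_deg ::
  "'r cdg_ring \<Rightarrow> int \<Rightarrow> ('r, 'a) cdg_module \<Rightarrow> ('r, 'b) cdg_module \<Rightarrow> (int \<Rightarrow> 'a \<Rightarrow> 'b) \<Rightarrow> bool" where
  "hom_deg R i L M f \<longleftrightarrow> graded_hom R L (shift i M) f"

definition hom_diff ::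
  "int \<Rightarrow> ('r, 'a) cdg_module \<Rightarrow> ('r, 'b) cdg_module \<Rightarrow> (int \<Rightarrow> 'a \<Rightarrow> 'b) \<Rightarrow> int \<Rightarrow> 'a \<Rightarrow> 'b" where
  "hom_diff i L M f n x =
     mdiff M (n + i) (f n x) \<otimes>\<^bsub>mcomp M (n + i + 1)\<^esub>
     inv\<^bsub>mcomp M (n + i + 1)\<^esub> (sgn_pow (mcomp M (n + i + 1)) i (f (n + 1) (mdiff L n x)))"

text \<open>The cocycles of degree 0 are the morphisms \<open>cdg_hom\<close>; a morphism of the homotopy category is
  represented by such an \<open>f\<close>, and \<open>homotopic\<close> is equality of the cohomology classes.\<close>

definition homotopic ::
  "'r cdg_ring \<Rightarrow> ('r, 'a) cdg_module \<Rightarrow> ('r, 'b) cdg_module \<Rightarrow>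
   (int \<Rightarrow> 'a \<Rightarrow> 'b) \<Rightarrow> (int \<Rightarrow> 'a \<Rightarrow> 'b) \<Rightarrow> bool" where
  "homotopic R L M f g \<longleftrightarrow>
     (\<exists>s. hom_deg R (-1) L M s \<and>
        (\<forall>n. \<forall>x\<in>carrier (mcomp L n).
           f n x \<otimes>\<^bsub>mcomp M n\<^esub> inv\<^bsub>mcomp M n\<^esub> (g n x) = hom_diff (-1) L M s n x))"

definition hot_iso ::
  "'r cdg_ring \<Rightarrow> ('r, 'a) cdg_module \<Rightarrow> ('r, 'b) cdg_module \<Rightarrow> (int \<Rightarrow> 'a \<Rightarrow> 'b) \<Rightarrow> bool" where
  "hot_iso R L M f \<longleftrightarrow>
     cdg_hom R L M f \<and>
     (\<exists>g. cdg_hom R M L g \<and>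
        homotopic R L L (comp_map g f) id_map \<and>
        homotopic R M M (comp_map f g) id_map)"

definition hot_isomorphic ::
  "'r cdg_ring \<Rightarrow> ('r, 'a) cdg_module \<Rightarrow> ('r, 'b) cdg_module \<Rightarrow> bool" where
  "hot_isomorphic R L M \<longleftrightarrow> (\<exists>f. hot_iso R L M f)"


section \<open>Cones, totalizations and distinguished triangles\<close>

text \<open>The cone of \<open>f\<close> from \<open>X\<close> to \<open>Y\<close> consists of the pairs \<open>(y, x)\<close> with \<open>x\<close> in \<open>shift 1 X\<close>.\<close>

definition cone ::
  "('r, 'a) cdg_module \<Rightarrow> ('r, 'b) cdg_module \<Rightarrow> (int \<Rightarrow> 'a \<Rightarrow> 'b) \<Rightarrow> ('r, 'b \<times> 'a) cdg_module" where
  "cone X Y f =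
     \<lparr>mcomp = (\<lambda>n. mcomp Y n \<times>\<times> mcomp (shift 1 X) n),
      act = (\<lambda>m n r (y, x). (act Y m n r y, act (shift 1 X) m n r x)),
      mdiff = (\<lambda>n (y, x). (mdiff Y n y \<otimes>\<^bsub>mcomp Y (n + 1)\<^esub> f (n + 1) x, mdiff (shift 1 X) n x))\<rparr>"

definition cone_incl :: "('r, 'a) cdg_module \<Rightarrow> int \<Rightarrow> 'b \<Rightarrow> 'b \<times> 'a" where
  "cone_incl X n y = (y, \<one>\<^bsub>mcomp (shift 1 X) n\<^esub>)"

definition cone_proj :: "int \<Rightarrow> 'b \<times> 'a \<Rightarrow> 'a" where
  "cone_proj n z = snd z"

text \<open>The iterated cone, for \<open>i\<close> from \<open>K\<close> to \<open>L\<close> and \<open>p\<close> from \<open>L\<close> to \<open>M\<close> with zero composition.\<close>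

definition Tot ::
  "('r, 'a) cdg_module \<Rightarrow> ('r, 'b) cdg_module \<Rightarrow> ('r, 'c) cdg_module \<Rightarrow>
   (int \<Rightarrow> 'a \<Rightarrow> 'b) \<Rightarrow> (int \<Rightarrow> 'b \<Rightarrow> 'c) \<Rightarrow> ('r, 'c \<times> 'b \<times> 'a) cdg_module" where
  "Tot K L M i p = cone (cone K L i) M (\<lambda>n (l, k). p n l)"

text \<open>From here on the objects of the categories are the CDG-modules whose components are carried by
  subsets of one type \<open>'u\<close>.  Constructions which lead out of that type (cones, totalizations, direct
  sums) are represented by the modules over \<open>'u\<close> isomorphic to them; such modules exist for all
  cones, totalizations and countable direct sums as soon as \<open>'u\<close> is infinite.\<close>

definition totalizations :: "'r cdg_ring \<Rightarrow> ('r, 'u) cdg_module set" where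
  "totalizations R =
     {Z. cdg_module R Z \<and>
         (\<exists>(K :: ('r, 'u) cdg_module) (L :: ('r, 'u) cdg_module) (M :: ('r, 'u) cdg_module) i p.
            cdg_short_exact R K L M i p \<and> cdg_isomorphic R Z (Tot K L M i p))}"

text \<open>A triangle in the homotopy category is distinguished if it is isomorphic, in the homotopy
  category, to the triangle of the cone of some \<open>f\<close> from \<open>A\<close> to \<open>B\<close>.\<close>

definition distinguished ::
  "'r cdg_ring \<Rightarrow> ('r, 'u) cdg_module \<Rightarrow> ('r, 'u) cdg_module \<Rightarrow> ('r, 'u) cdg_module \<Rightarrow>
   (int \<Rightarrow> 'u \<Rightarrow> 'u) \<Rightarrow> (int \<Rightarrow> 'u \<Rightarrow> 'u) \<Rightarrow> (int \<Rightarrow> 'u \<Rightarrow> 'u) \<Rightarrow> bool" where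
  "distinguished R X Y Z u v w \<longleftrightarrow>
     cdg_module R X \<and> cdg_module R Y \<and> cdg_module R Z \<and>
     cdg_hom R X Y u \<and> cdg_hom R Y Z v \<and> cdg_hom R Z (shift 1 X) w \<and>
     (\<exists>(A :: ('r, 'u) cdg_module) (B :: ('r, 'u) cdg_module) f a b c.
        cdg_module R A \<and> cdg_module R B \<and> cdg_hom R A B f \<and>
        hot_iso R X A a \<and> hot_iso R Y B b \<and> hot_iso R Z (cone A B f) c \<and>
        homotopic R X B (comp_map b u) (comp_map f a) \<and>
        homotopic R Y (cone A B f) (comp_map c v) (comp_map (cone_incl A) b) \<and>
        homotopic R Z (shift 1 A) (comp_map (shift_map 1 a) w) (comp_map cone_proj c))"

text \<open>A full subcategory is identified with its class of objects.\<close>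

definition full_triangulated_subcategory ::
  "'r cdg_ring \<Rightarrow> ('r, 'u) cdg_module set \<Rightarrow> bool" where
  "full_triangulated_subcategory R S \<longleftrightarrow>
     S \<subseteq> {X. cdg_module R X} \<and> S \<noteq> {} \<and>
     (\<forall>X Y. X \<in> S \<and> cdg_module R Y \<and> hot_isomorphic R X Y \<longrightarrow> Y \<in> S) \<and>
     (\<forall>X i. X \<in> S \<longrightarrow> shift i X \<in> S) \<and>
     (\<forall>X Y Z u v w. distinguished R X Y Z u v w \<longrightarrow>
        (X \<in> S \<and> Y \<in> S \<longrightarrow> Z \<in> S) \<and> (Y \<in> S \<and> Z \<in> S \<longrightarrow> X \<in> S) \<and> (X \<in> S \<and> Z \<in> S \<longrightarrow> Y \<in> S))"

definition closed_under_countable_sums ::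
  "'r cdg_ring \<Rightarrow> ('r, 'u) cdg_module set \<Rightarrow> bool" where
  "closed_under_countable_sums R S \<longleftrightarrow>
     (\<forall>(I :: nat set) X Y.
        (\<forall>i\<in>I. X i \<in> S) \<and> cdg_module R Y \<and> hot_isomorphic R Y (direct_sum I X) \<longrightarrow> Y \<in> S)"

definition minimal_triangulated_countable_sums ::
  "'r cdg_ring \<Rightarrow> ('r, 'u) cdg_module set \<Rightarrow> ('r, 'u) cdg_module set" where
  "minimal_triangulated_countable_sums R G =
     \<Inter>{S. full_triangulated_subcategory R S \<and> closed_under_countable_sums R S \<and> G \<subseteq> S}"


section \<open>Filtrations indexed by an ordinal\<close>

text \<open>An element \<open>\<alpha>\<close> of a well-ordered type stands for the order type of \<open>{..<\<alpha>}\<close>; the ordinals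
  not exceeding it correspond to the elements of \<open>{..\<alpha>}\<close>.\<close>

definition ord_zero :: "'i::wellorder" where
  "ord_zero = (LEAST i. True)"

definition ord_succ :: "'i::wellorder \<Rightarrow> 'i" where
  "ord_succ i = (LEAST j. i < j)"

definition ord_limit :: "'i::wellorder \<Rightarrow> bool" where
  "ord_limit i \<longleftrightarrow> i \<noteq> ord_zero \<and> (\<forall>j<i. ord_succ j < i)"

definition filtration ::
  "'r cdg_ring \<Rightarrow> 'i::wellorder \<Rightarrow> ('r, 'u) cdg_module \<Rightarrow> ('i \<Rightarrow> int \<Rightarrow> 'u set) \<Rightarrow> bool" where
  "filtration R \<alpha> M F \<longleftrightarrow>
     (\<forall>i\<le>\<alpha>. cdg_submodule R (F i) M) \<and>
     (\<forall>n. F ord_zero n = {\<one>\<^bsub>mcomp M n\<^esub>}) \<and>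
     (\<forall>n. F \<alpha> n = carrier (mcomp M n)) \<and>
     (\<forall>i j n. j \<le> i \<and> i \<le> \<alpha> \<longrightarrow> F j n \<subseteq> F i n) \<and>
     (\<forall>i n. ord_limit i \<and> i \<le> \<alpha> \<longrightarrow> F i n = (\<Union>j\<in>{..<i}. F j n))"

definition Fil ::
  "'r cdg_ring \<Rightarrow> 'i::wellorder \<Rightarrow> ('r, 'u) cdg_module set \<Rightarrow> ('r, 'u) cdg_module set" where
  "Fil R \<alpha> \<T> =
     {M. cdg_module R M \<and>
         (\<exists>F. filtration R \<alpha> M F \<and>
              (\<forall>i<\<alpha>. \<exists>T\<in>\<T>.
                 cdg_isomorphic R (quotient_module (restrict_module M (F (ord_succ i))) (F i)) T))}"

end

theory Submission
  imports Defs "HOL-Algebra.FiniteProduct"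
begin

text \<open>Let \<open>S\<close> be a triangulated subcategory which is closed under countable direct sums and contains
  \<open>\<T>\<close> and the totalizations.  In the homotopy category a short exact sequence \<open>0 \<rightarrow> K \<rightarrow> L \<rightarrow> M \<rightarrow> 0\<close>
  of modules need not give a triangle; the totalization measures the failure, being the cone of the
  comparison map from the cone of \<open>K \<rightarrow> L\<close> to \<open>M\<close>.  As \<open>S\<close> contains the totalizations, it treats
  short exact sequences as if they were triangles: if \<open>K\<close> and one of \<open>L\<close> and \<open>M\<close> belong to \<open>S\<close>, so
  does the other (\<open>short_exact_in_triangulated\<close>).

  All the steps \<open>F i\<close> of a filtration lie in \<open>S\<close>, by transfinite induction
  (\<open>filtration_in_triangulated\<close>).  Zero is an empty direct sum, and a successor step is an extension
  of an object of \<open>\<T>\<close> by the preceding step.  A limit ordinal \<open>i\<close> not exceeding a countable ordinal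
  is the supremum of a sequence of smaller ordinals \<open>s k\<close>, so that \<open>F i\<close> is the union of the
  increasing sequence of the \<open>F (s k)\<close> and there is the short exact telescope sequence
  \<open>0 \<rightarrow> \<Oplus>F (s k) \<rightarrow> \<Oplus>F (s k) \<rightarrow> F i \<rightarrow> 0\<close>, with the identity minus the shift as first map and the
  sum as second map (\<open>telescope_short_exact\<close>).  Its first two terms are countable direct sums of
  objects of \<open>S\<close>, hence \<open>F i\<close> is in \<open>S\<close>.

  The objects of \<open>S\<close> are modules over a single type.  Cones and countable direct sums are therefore
  replaced by isomorphic modules over that type, which exist because it is infinite
  (\<open>ex_small_cone\<close>, \<open>ex_small_direct_sum\<close>); isomorphic modules are isomorphic in the homotopy
  category.\<close>

section \<open>Signs and elements of modules\<close>

lemma sgn_pow_closed [simp]: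
  "group G \<Longrightarrow> x \<in> carrier G \<Longrightarrow> sgn_pow G k x \<in> carrier G"
  by (simp add: sgn_pow_def)

lemma sgn_pow_one [simp]: "group G \<Longrightarrow> sgn_pow G k \<one>\<^bsub>G\<^esub> = \<one>\<^bsub>G\<^esub>"
  by (simp add: sgn_pow_def group.is_monoid monoid.inv_one)

lemma sgn_pow_sgn_pow [simp]:
  "group G \<Longrightarrow> x \<in> carrier G \<Longrightarrow> sgn_pow G k (sgn_pow G l x) = sgn_pow G (k + l) x"
  by (auto simp add: sgn_pow_def)

lemma sgn_pow_mult:
  "comm_group G \<Longrightarrow> x \<in> carrier G \<Longrightarrow> y \<in> carrier G \<Longrightarrow>
    sgn_pow G k (x \<otimes>\<^bsub>G\<^esub> y) = sgn_pow G k x \<otimes>\<^bsub>G\<^esub> sgn_pow G k y"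
  by (simp add: sgn_pow_def comm_group.inv_mult)

lemma hom_sgn_pow:
  assumes "group G" "group H" "h \<in> hom G H" "x \<in> carrier G"
  shows "h (sgn_pow G k x) = sgn_pow H k (h x)"
  using assms group_hom.hom_inv[of G H h x]
  by (simp add: sgn_pow_def group_hom_def group_hom_axioms_def)

text \<open>Negation is read as the sign of exponent 1, so that the rules for signs also normalise inverses.\<close>

lemma inv_eq_sgn_pow: "inv\<^bsub>G\<^esub> x = sgn_pow G 1 x"
  by (simp add: sgn_pow_def)

lemma sgn_pow_parity: "even k = even l \<Longrightarrow> sgn_pow G k x = sgn_pow G l x"
  by (simp add: sgn_pow_def)

text \<open>One degree occurs in many forms, such as \<open>n + 1 + i\<close> and \<open>n + i + 1\<close>.  The following rules
  therefore take a degree as a separate variable together with an equation for it; they then apply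
  to every form of the degree, and the simplifier proves the equation by arithmetic.\<close>

context cdg_ring
begin

lemma rcomp_group [simp]: "group (rcomp R n)"
  using rcomp_comm_group comm_group.axioms(2) by blast

lemma rdiff_closed [simp]:
  "r \<in> carrier (rcomp R m) \<Longrightarrow> k = m + 1 \<Longrightarrow> rdiff R m r \<in> carrier (rcomp R k)"
  using rdiff_hom[of m] by (simp add: hom_def Pi_iff)

end

context cdg_module
begin

lemma mcomp_group [simp]: "group (mcomp M n)"
  using mcomp_comm_group comm_group.axioms(2) by blast

lemma mcomp_mult_closed [simp]:
  "x \<in> carrier (mcomp M n) \<Longrightarrow> y \<in> carrier (mcomp M n) \<Longrightarrow> x \<otimes>\<^bsub>mcomp M n\<^esub> y \<in> carrier (mcomp M n)"
  by (meson group.is_monoid mcomp_group monoid.m_closed)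

lemma mcomp_one_closed [simp]: "\<one>\<^bsub>mcomp M n\<^esub> \<in> carrier (mcomp M n)"
  by (meson group.is_monoid mcomp_group monoid.one_closed)

lemma act_closed [simp]:
  "r \<in> carrier (rcomp R m) \<Longrightarrow> x \<in> carrier (mcomp M n) \<Longrightarrow> k = m + n \<Longrightarrow>
    act M m n r x \<in> carrier (mcomp M k)"
  using act_hom_right[of r m n] by (simp add: hom_def Pi_iff)

lemma mdiff_closed [simp]:
  "x \<in> carrier (mcomp M n) \<Longrightarrow> k = n + 1 \<Longrightarrow> mdiff M n x \<in> carrier (mcomp M k)"
  using mdiff_hom[of n] by (simp add: hom_def Pi_iff)

lemma act_mult_left:
  "r \<in> carrier (rcomp R m) \<Longrightarrow> s \<in> carrier (rcomp R m) \<Longrightarrow> x \<in> carrier (mcomp M n) \<Longrightarrow> m' = m \<Longrightarrow>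
    act M m n (r \<otimes>\<^bsub>rcomp R m'\<^esub> s) x = act M m n r x \<otimes>\<^bsub>mcomp M (m + n)\<^esub> act M m n s x"
  using act_hom_left[of x n m] by (simp add: hom_def)

lemma act_mult_right:
  "r \<in> carrier (rcomp R m) \<Longrightarrow> x \<in> carrier (mcomp M n) \<Longrightarrow> y \<in> carrier (mcomp M n) \<Longrightarrow> n' = n \<Longrightarrow>
    act M m n r (x \<otimes>\<^bsub>mcomp M n'\<^esub> y) = act M m n r x \<otimes>\<^bsub>mcomp M (m + n)\<^esub> act M m n r y"
  using act_hom_right[of r m n] by (simp add: hom_def)

lemma act_one_right:
  "r \<in> carrier (rcomp R m) \<Longrightarrow> n' = n \<Longrightarrow> act M m n r \<one>\<^bsub>mcomp M n'\<^esub> = \<one>\<^bsub>mcomp M (m + n)\<^esub>"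
  using hom_one[OF act_hom_right[of r m n]] by simp

lemma act_sgn_pow:
  "r \<in> carrier (rcomp R m) \<Longrightarrow> x \<in> carrier (mcomp M n) \<Longrightarrow> n' = n \<Longrightarrow>
    act M m n r (sgn_pow (mcomp M n') k x) = sgn_pow (mcomp M (m + n)) k (act M m n r x)"
  using hom_sgn_pow[OF _ _ act_hom_right[of r m n]] by simp

lemma mdiff_mult:
  "x \<in> carrier (mcomp M n) \<Longrightarrow> y \<in> carrier (mcomp M n) \<Longrightarrow> n' = n \<Longrightarrow>
    mdiff M n (x \<otimes>\<^bsub>mcomp M n'\<^esub> y) = mdiff M n x \<otimes>\<^bsub>mcomp M (n + 1)\<^esub> mdiff M n y"
  using mdiff_hom[of n] by (simp add: hom_def)

lemma mdiff_one: "n' = n \<Longrightarrow> mdiff M n \<one>\<^bsub>mcomp M n'\<^esub> = \<one>\<^bsub>mcomp M (n + 1)\<^esub>"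
  using hom_one[OF mdiff_hom[of n]] by simp

lemma mdiff_sgn_pow:
  "x \<in> carrier (mcomp M n) \<Longrightarrow> n' = n \<Longrightarrow>
    mdiff M n (sgn_pow (mcomp M n') k x) = sgn_pow (mcomp M (n + 1)) k (mdiff M n x)"
  using hom_sgn_pow[OF _ _ mdiff_hom[of n]] by simp

lemma act_act:
  "r \<in> carrier (rcomp R m) \<Longrightarrow> s \<in> carrier (rcomp R n) \<Longrightarrow> x \<in> carrier (mcomp M k) \<Longrightarrow>
    l = m + n \<Longrightarrow> act M l k (rmul R m n r s) x = act M m (n + k) r (act M n k s x)"
  using act_assoc by simp

lemma mdiff_act:
  "r \<in> carrier (rcomp R m) \<Longrightarrow> x \<in> carrier (mcomp M n) \<Longrightarrow> k = m + n \<Longrightarrow>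
    mdiff M k (act M m n r x) =
      act M (m + 1) n (rdiff R m r) x \<otimes>\<^bsub>mcomp M (m + n + 1)\<^esub>
      sgn_pow (mcomp M (m + n + 1)) m (act M m (n + 1) r (mdiff M n x))"
  using mdiff_Leibniz by simp

lemma mdiff_twice:
  "x \<in> carrier (mcomp M n) \<Longrightarrow> k = n + 1 \<Longrightarrow> mdiff M k (mdiff M n x) = act M 2 n (rcurv R) x"
  using mdiff_mdiff by simp

lemmas module_simps = mcomp_comm_group sgn_pow_mult act_mult_left act_mult_right
  act_one_right act_sgn_pow mdiff_mult mdiff_one mdiff_sgn_pow mdiff_twice

end

section \<open>Shifts, submodules and cones\<close>

lemma mcomp_shift [simp]: "mcomp (shift i M) n = mcomp M (n + i)"
  by (simp add: shift_def)

text \<open>The signs of the Leibniz rule agree because \<open>i + i m = i (m + 1)\<close>, and those of the square of the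
  differential because \<open>i + i\<close> and \<open>2 i\<close> are even.\<close>

lemma cdg_module_shift:
  fixes M :: "('r, 'u) cdg_module"
  assumes "cdg_module R M"
  shows "cdg_module R (shift i M)"
proof -
  interpret cdg_module R M by fact
  show ?thesis
  proof (intro cdg_module.intro[OF cdg_ring_axioms] cdg_module_axioms.intro, goal_cases)
    case (1 n)
    then show ?case by (simp add: mcomp_comm_group)
  next
    case (2 x n m)
    then show ?case
      by (auto intro!: homI simp: shift_def module_simps add.assoc)
  next
    case (3 r m n)
    then show ?case
      by (auto intro!: homI simp: shift_def module_simps add.assoc)
  next
    case (4 r m s n x k)
    then show ?case
      by (simp add: shift_def module_simps act_act algebra_simps)
  next
    case (5 x n)
    then show ?case by (simp add: shift_def act_unit sgn_pow_def)
  next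
    case (6 n)
    then show ?case
      by (auto intro!: homI simp: shift_def module_simps add_ac)
  next
    case (7 r m x n)
    then show ?case
      by (simp add: shift_def module_simps mdiff_act algebra_simps)
  next
    case (8 x n)
    then show ?case
      apply (simp add: shift_def module_simps rcurv_closed add_ac)
      by (intro sgn_pow_parity) simp
  qed
qed

lemma mcomp_restrict_module [simp]:
  "mcomp (restrict_module M N) n = (mcomp M n)\<lparr>carrier := N n\<rparr>"
  "act (restrict_module M N) = act M" "mdiff (restrict_module M N) = mdiff M"
  by (simp_all add: restrict_module_def)

lemma cdg_module_restrict_module:
  assumes "cdg_module R M" and N: "cdg_submodule R N M"
  shows "cdg_module R (restrict_module M N)"
proof -
  interpret cdg_module R M by fact
  have sub: "subgroup (N n) (mcomp M n)" for n
    using N by (simp add: cdg_submodule_def)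
  have inN [simp]: "x \<in> N n \<Longrightarrow> x \<in> carrier (mcomp M n)" for x n
    using subgroup.subset[OF sub] by blast
  have actN [simp]: "r \<in> carrier (rcomp R m) \<Longrightarrow> x \<in> N n \<Longrightarrow> act M m n r x \<in> N (m + n)" for m n r x
    using N by (simp add: cdg_submodule_def)
  have diffN [simp]: "x \<in> N n \<Longrightarrow> mdiff M n x \<in> N (n + 1)" for n x
    using N by (simp add: cdg_submodule_def)
  have sgn: "sgn_pow ((mcomp M n)\<lparr>carrier := N n\<rparr>) k x = sgn_pow (mcomp M n) k x"
    if "x \<in> N n'" "n' = n" for x n n' k
    using that by (simp add: sgn_pow_def group.m_inv_consistent[OF _ sub])
  show ?thesis
  proof (intro cdg_module.intro[OF cdg_ring_axioms] cdg_module_axioms.intro, goal_cases)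
    case (1 n)
    interpret comm_group "mcomp M n" by (rule mcomp_comm_group)
    show ?case
      using subgroup.subgroup_is_group[OF sub group_axioms] by (auto intro!: group.group_comm_groupI simp: m_comm)
  next
    case (2 x n m)
    then show ?case by (auto intro!: homI simp: module_simps)
  next
    case (3 r m n)
    then show ?case by (auto intro!: homI simp: module_simps)
  next
    case (4 r m s n x k)
    then show ?case by (simp add: act_act)
  next
    case (5 x n)
    then show ?case by (simp add: act_unit)
  next
    case (6 n)
    then show ?case by (auto intro!: homI simp: module_simps)
  next
    case (7 r m x n)
    then show ?case
      using sgn[OF actN[OF 7(1) diffN], of x n "m + n + 1"] by (simp add: mdiff_act)
  next
    case (8 x n)
    then show ?case by (simp add: mdiff_twice)
  qed
qed

lemma cdg_homI:
  assumes "\<And>n x. x \<in> carrier (mcomp L n) \<Longrightarrow> f n x \<in> carrier (mcomp M n)"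
    and "\<And>n x y. x \<in> carrier (mcomp L n) \<Longrightarrow> y \<in> carrier (mcomp L n) \<Longrightarrow>
      f n (x \<otimes>\<^bsub>mcomp L n\<^esub> y) = f n x \<otimes>\<^bsub>mcomp M n\<^esub> f n y"
    and "\<And>m n r x. r \<in> carrier (rcomp R m) \<Longrightarrow> x \<in> carrier (mcomp L n) \<Longrightarrow>
      f (m + n) (act L m n r x) = act M m n r (f n x)"
    and "\<And>n x. x \<in> carrier (mcomp L n) \<Longrightarrow> f (n + 1) (mdiff L n x) = mdiff M n (f n x)"
  shows "cdg_hom R L M f"
  using assms by (auto simp: cdg_hom_def graded_hom_def intro!: homI)

locale cdg_morphism = dom: cdg_module R L + cod: cdg_module R M
  for R :: "'r cdg_ring" and L :: "('r, 'a) cdg_module" and M :: "('r, 'b) cdg_module" +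
  fixes f :: "int \<Rightarrow> 'a \<Rightarrow> 'b"
  assumes cdg_hom: "cdg_hom R L M f"
begin

lemma map_hom: "f n \<in> hom (mcomp L n) (mcomp M n)"
  using cdg_hom by (simp add: cdg_hom_def graded_hom_def)

lemma map_closed [simp]: "x \<in> carrier (mcomp L n) \<Longrightarrow> n' = n \<Longrightarrow> f n x \<in> carrier (mcomp M n')"
  using map_hom[of n] by (auto simp: hom_def)

lemma map_mult:
  "x \<in> carrier (mcomp L n) \<Longrightarrow> y \<in> carrier (mcomp L n) \<Longrightarrow> n' = n \<Longrightarrow>
    f n (x \<otimes>\<^bsub>mcomp L n'\<^esub> y) = f n x \<otimes>\<^bsub>mcomp M n\<^esub> f n y"
  using map_hom[of n] by (simp add: hom_def)

lemma map_one: "n' = n \<Longrightarrow> f n \<one>\<^bsub>mcomp L n'\<^esub> = \<one>\<^bsub>mcomp M n\<^esub>"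
  using hom_one[OF map_hom[of n]] by simp

lemma map_sgn_pow:
  "x \<in> carrier (mcomp L n) \<Longrightarrow> n' = n \<Longrightarrow>
    f n (sgn_pow (mcomp L n') k x) = sgn_pow (mcomp M n) k (f n x)"
  using hom_sgn_pow[OF _ _ map_hom[of n]] by simp

lemma map_act:
  "r \<in> carrier (rcomp R m) \<Longrightarrow> x \<in> carrier (mcomp L n) \<Longrightarrow> k = m + n \<Longrightarrow>
    f k (act L m n r x) = act M m n r (f n x)"
  using cdg_hom by (simp add: cdg_hom_def graded_hom_def)

lemma map_mdiff:
  "x \<in> carrier (mcomp L n) \<Longrightarrow> k = n + 1 \<Longrightarrow> f k (mdiff L n x) = mdiff M n (f n x)"
  using cdg_hom by (simp add: cdg_hom_def)

lemmas map_simps = map_mult map_one map_sgn_pow map_act map_mdiff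

end

lemma cdg_morphismI: "cdg_module R L \<Longrightarrow> cdg_module R M \<Longrightarrow> cdg_hom R L M f \<Longrightarrow> cdg_morphism R L M f"
  by (simp add: cdg_morphism_def cdg_morphism_axioms_def)

lemma cone_simps [simp]:
  "mcomp (cone X Y f) n = mcomp Y n \<times>\<times> mcomp X (n + 1)"
  "act (cone X Y f) m n r (y, x) =
     (act Y m n r y, sgn_pow (mcomp X (m + n + 1)) m (act X m (n + 1) r x))"
  "mdiff (cone X Y f) n (y, x) =
     (mdiff Y n y \<otimes>\<^bsub>mcomp Y (n + 1)\<^esub> f (n + 1) x,
      inv\<^bsub>mcomp X (n + 1 + 1)\<^esub> (mdiff X (n + 1) x))"
  by (simp_all add: cone_def shift_def inv_eq_sgn_pow)

lemma sgn_pow_DirProd [simp]: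
  "group G \<Longrightarrow> group H \<Longrightarrow> x \<in> carrier G \<Longrightarrow> y \<in> carrier H \<Longrightarrow>
    sgn_pow (G \<times>\<times> H) k (x, y) = (sgn_pow G k x, sgn_pow H k y)"
  by (simp add: sgn_pow_def)

lemma DirProd_comm_group:
  assumes "comm_group G" "comm_group H"
  shows "comm_group (G \<times>\<times> H)"
proof -
  interpret G: comm_group G by fact
  interpret H: comm_group H by fact
  interpret group "G \<times>\<times> H" by (rule DirProd_group) unfold_locales
  show ?thesis by (rule group_comm_groupI) (auto simp: G.m_comm H.m_comm)
qed

lemma (in comm_group) mult_swap4:
  assumes "a \<in> carrier G" "b \<in> carrier G" "c \<in> carrier G" "d \<in> carrier G"
  shows "(a \<otimes> b) \<otimes> (c \<otimes> d) = (a \<otimes> c) \<otimes> (b \<otimes> d)"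
  using assms by (simp add: m_ac)

text \<open>The first coordinate of the differential contains \<open>f x\<close>.  In the Leibniz rule this term keeps the
  sign that the action on the shift has put on \<open>x\<close>; in the square of the differential it contributes
  \<open>d (f x) - f (d x)\<close>, which vanishes since \<open>f\<close> commutes with the differentials.\<close>

lemma (in cdg_morphism) cdg_module_cone: "cdg_module R (cone L M f)"
proof (intro cdg_module.intro[OF dom.cdg_ring_axioms] cdg_module_axioms.intro, goal_cases)
  case (1 n)
  show ?case by (simp add: DirProd_comm_group cod.mcomp_comm_group dom.mcomp_comm_group)
next
  case (2 x n m)
  then show ?case
    by (cases x) (auto intro!: homI simp: dom.module_simps cod.module_simps algebra_simps)
next
  case (3 r m n)
  then show ?case
    by (auto intro!: homI simp: dom.module_simps cod.module_simps algebra_simps)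
next
  case (4 r m s n x k)
  then show ?case
    by (cases x) (simp add: dom.module_simps cod.module_simps dom.act_act cod.act_act algebra_simps)
next
  case (5 x n)
  then show ?case by (cases x) (simp add: dom.act_unit cod.act_unit sgn_pow_def)
next
  case (6 n)
  show ?case
    by (auto intro!: homI simp: dom.module_simps cod.module_simps map_simps inv_eq_sgn_pow algebra_simps
        comm_group.mult_swap4)
next
  case (7 r m x n)
  obtain a b where x: "x = (a, b)" by (cases x)
  have ab: "a \<in> carrier (mcomp M n)" "b \<in> carrier (mcomp L (n + 1))" using 7 x by auto
  interpret G: comm_group "mcomp M (m + n + 1)" by (rule cod.mcomp_comm_group)
  \<comment> \<open>In the second coordinate the signs of the Leibniz rule, of the shifted differential and of the
    shifted action multiply to a single minus.\<close>
  have "sgn_pow G (m + (1 + m)) = sgn_pow G 1" for G :: "'a monoid"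
    by (rule ext, rule sgn_pow_parity) simp
  moreover have "rdiff R m r \<in> carrier (rcomp R (1 + m))" using 7 by simp
  \<comment> \<open>The simplification of \<open>G.m_assoc\<close> brings its degree into the form that \<open>algebra_simps\<close> produces
    in the goal.\<close>
  ultimately show ?case using 7(1) ab unfolding x
    by (simp add: dom.module_simps cod.module_simps map_simps dom.mdiff_act cod.mdiff_act
         inv_eq_sgn_pow algebra_simps G.m_assoc[simplified algebra_simps])
next
  case (8 x n)
  obtain a b where x: "x = (a, b)" by (cases x)
  have ab: "a \<in> carrier (mcomp M n)" "b \<in> carrier (mcomp L (n + 1))" using 8 x by auto
  interpret G: comm_group "mcomp M (n + 2)" by (rule cod.mcomp_comm_group)
  \<comment> \<open>The two contributions of \<open>f\<close> to the first coordinate cancel by this.\<close>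
  have "z \<otimes>\<^bsub>mcomp M (n + 2)\<^esub> sgn_pow (mcomp M (n + 2)) 1 z = \<one>\<^bsub>mcomp M (n + 2)\<^esub>"
    if "z \<in> carrier (mcomp M (n + 2))" for z
    using that by (simp add: sgn_pow_def)
  with ab show ?case unfolding x
    by (simp add: dom.module_simps cod.module_simps map_simps dom.mdiff_act cod.mdiff_act
        dom.rcurv_closed
         inv_eq_sgn_pow algebra_simps G.m_assoc[simplified algebra_simps])
qed

section \<open>Transport of structure\<close>

text \<open>The injection \<open>e n\<close> may vary with the degree: for a direct sum it is built from the zeros of the
  summands in that degree.\<close>

definition transport ::
  "(int \<Rightarrow> 'a \<Rightarrow> 'b) \<Rightarrow> ('r, 'a) cdg_module \<Rightarrow> ('r, 'b) cdg_module" where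
  "transport e M =
     (let g = (\<lambda>n. inv_into (carrier (mcomp M n)) (e n))
      in \<lparr>mcomp = (\<lambda>n. \<lparr>carrier = e n ` carrier (mcomp M n),
                        mult = (\<lambda>x y. e n (g n x \<otimes>\<^bsub>mcomp M n\<^esub> g n y)),
                        one = e n \<one>\<^bsub>mcomp M n\<^esub>\<rparr>),
          act = (\<lambda>m n r x. e (m + n) (act M m n r (g n x))),
          mdiff = (\<lambda>n x. e (n + 1) (mdiff M n (g n x)))\<rparr>)"

lemma transport:
  assumes "cdg_module R M" and inj: "\<And>n. inj_on (e n) (carrier (mcomp M n))"
  shows cdg_module_transport: "cdg_module R (transport e M)"
    and cdg_isomorphic_transport: "cdg_isomorphic R M (transport e M)"
proof -
  interpret cdg_module R M by fact
  let ?T = "transport e M"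
  have carr [simp]: "carrier (mcomp ?T n) = e n ` carrier (mcomp M n)" for n
    by (simp add: transport_def)
  have one [simp]: "\<one>\<^bsub>mcomp ?T n\<^esub> = e n \<one>\<^bsub>mcomp M n\<^esub>" for n
    by (simp add: transport_def)
  have mult: "e n x \<otimes>\<^bsub>mcomp ?T k\<^esub> e n y = e n (x \<otimes>\<^bsub>mcomp M n\<^esub> y)"
    if "x \<in> carrier (mcomp M n)" "y \<in> carrier (mcomp M n)" "k = n" for n k x y
    using that inj by (simp add: transport_def Let_def)
  have act: "act ?T m n r (e n x) = e (m + n) (act M m n r x)"
    if "x \<in> carrier (mcomp M n)" for m n r x
    using that inj by (simp add: transport_def Let_def)
  have diff: "mdiff ?T k (e n x) = e (n + 1) (mdiff M n x)"
    if "x \<in> carrier (mcomp M n)" "k = n" for k n x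
    using that inj by (simp add: transport_def Let_def)
  have act': "act ?T m k r (e n x) = e (m + n) (act M m n r x)"
    if "x \<in> carrier (mcomp M n)" "k = n" for k m n r x
    using that act by simp
  have grp: "comm_group (mcomp ?T n)" for n
  proof -
    interpret comm_group "mcomp M n" by (rule mcomp_comm_group)
    have "\<exists>y \<in> carrier (mcomp ?T n). y \<otimes>\<^bsub>mcomp ?T n\<^esub> x = \<one>\<^bsub>mcomp ?T n\<^esub>"
      if x: "x \<in> carrier (mcomp ?T n)" for x
    proof -
      obtain a where a: "a \<in> carrier (mcomp M n)" "x = e n a" using x by auto
      show ?thesis by (rule bexI[of _ "e n (inv\<^bsub>mcomp M n\<^esub> a)"]) (simp_all add: a mult)
    qed
    then show ?thesis by (intro comm_groupI) (auto simp: mult m_ac)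
  qed
  then have grp': "group (mcomp ?T n)" for n using comm_group.axioms(2) by blast
  have hom: "e n \<in> hom (mcomp M n) (mcomp ?T n)" for n
    by (auto simp: hom_def mult)
  have sgn: "sgn_pow (mcomp ?T k') k (e n x) = e n (sgn_pow (mcomp M n) k x)"
    if "x \<in> carrier (mcomp M n)" "k' = n" for n x k k'
    using hom_sgn_pow[OF _ grp' hom that(1)] that(2) by simp
  show "cdg_module R ?T"
  proof (intro cdg_module.intro[OF cdg_ring_axioms] cdg_module_axioms.intro, goal_cases)
    case (1 n)
    then show ?case by (rule grp)
  next
    case (2 x n m)
    then show ?case by (auto intro!: homI simp: mult act module_simps)
  next
    case (3 r m n)
    then show ?case by (auto intro!: homI simp: mult act module_simps)
  next
    case (4 r m s n x k)
    then show ?case by (auto simp: mult act' act_act add.assoc)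
  next
    case (5 x n)
    then show ?case by (auto simp: act act_unit)
  next
    case (6 n)
    then show ?case by (auto intro!: homI simp: mult diff module_simps)
  next
    case (7 r m x n)
    then show ?case by (auto simp: mult diff act' sgn mdiff_act add_ac)
  next
    case (8 x n)
    then show ?case by (auto simp: diff act' mdiff_twice add_ac)
  qed
  show "cdg_isomorphic R M ?T"
    unfolding cdg_isomorphic_def
    by (intro exI[of _ e] conjI cdg_homI allI) (auto simp: mult diff act bij_betw_def inj)
qed

section \<open>Isomorphisms in the homotopy category\<close>

lemma cdg_hom_comp:
  "cdg_hom R L M f \<Longrightarrow> cdg_hom R M N g \<Longrightarrow> cdg_hom R L N (comp_map g f)"
  by (force simp: cdg_hom_def graded_hom_def comp_map_def hom_def Pi_iff)

lemma cdg_hom_id: "cdg_hom R L L id_map"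
  by (auto simp: cdg_hom_def graded_hom_def id_map_def hom_def)

lemma (in cdg_morphism) cdg_hom_inverse:
  assumes bij: "\<And>n. bij_betw (f n) (carrier (mcomp L n)) (carrier (mcomp M n))"
  shows "cdg_hom R M L (\<lambda>n. inv_into (carrier (mcomp L n)) (f n))"
proof -
  let ?g = "\<lambda>n. inv_into (carrier (mcomp L n)) (f n)"
  have gf: "?g n (f n' x) = x" if "x \<in> carrier (mcomp L n)" "n' = n" for n n' x
    using that bij_betw_inv_into_left[OF bij] by simp
  have sur: "\<exists>a. a \<in> carrier (mcomp L n) \<and> x = f n a" if "x \<in> carrier (mcomp M n)" for n x
    using bij[of n] that by (auto simp: bij_betw_def)
  show ?thesis
  proof (rule cdg_homI)
    fix n x assume "x \<in> carrier (mcomp M n)"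
    then obtain a where a: "a \<in> carrier (mcomp L n)" "x = f n a" using sur by blast
    then show "?g n x \<in> carrier (mcomp L n)" by (simp add: gf)
    have "?g (n + 1) (f (n + 1) (mdiff L n a)) = mdiff L n a"
      using a by (intro gf) auto
    then show "?g (n + 1) (mdiff M n x) = mdiff L n (?g n x)"
      using a by (simp add: gf map_mdiff)
  next
    fix n x y assume "x \<in> carrier (mcomp M n)" "y \<in> carrier (mcomp M n)"
    then obtain a b where a: "a \<in> carrier (mcomp L n)" "x = f n a"
      "b \<in> carrier (mcomp L n)" "y = f n b" using sur by blast
    have "?g n (f n (a \<otimes>\<^bsub>mcomp L n\<^esub> b)) = a \<otimes>\<^bsub>mcomp L n\<^esub> b"
      using a by (intro gf) auto
    then show "?g n (x \<otimes>\<^bsub>mcomp M n\<^esub> y) = ?g n x \<otimes>\<^bsub>mcomp L n\<^esub> ?g n y"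
      using a by (simp add: gf map_mult)
  next
    fix m n r x assume r: "r \<in> carrier (rcomp R m)" "x \<in> carrier (mcomp M n)"
    then obtain a where a: "a \<in> carrier (mcomp L n)" "x = f n a" using sur by blast
    have "?g (m + n) (f (m + n) (act L m n r a)) = act L m n r a"
      using a r by (intro gf) auto
    then show "?g (m + n) (act M m n r x) = act L m n r (?g n x)"
      using a r by (simp add: gf map_act)
  qed
qed

lemma cdg_isomorphic_sym:
  assumes "cdg_module R L" "cdg_module R M" "cdg_isomorphic R L M"
  shows "cdg_isomorphic R M L"
proof -
  obtain f where f: "cdg_hom R L M f" "\<forall>n. bij_betw (f n) (carrier (mcomp L n)) (carrier (mcomp M n))"
    using assms(3) by (auto simp: cdg_isomorphic_def)
  interpret cdg_morphism R L M f by (intro cdg_morphismI assms f)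
  show ?thesis using cdg_hom_inverse f(2) bij_betw_inv_into unfolding cdg_isomorphic_def by blast
qed

lemma cdg_isomorphic_trans:
  assumes "cdg_isomorphic R L M" "cdg_isomorphic R M N"
  shows "cdg_isomorphic R L N"
proof -
  obtain f g where fg: "cdg_hom R L M f" "\<And>n. bij_betw (f n) (carrier (mcomp L n)) (carrier (mcomp M n))"
    "cdg_hom R M N g" "\<And>n. bij_betw (g n) (carrier (mcomp M n)) (carrier (mcomp N n))"
    using assms by (auto simp: cdg_isomorphic_def)
  have "comp_map g f n = g n \<circ> f n" for n by (auto simp: comp_map_def)
  then show ?thesis
    using cdg_hom_comp[OF fg(1,3)] bij_betw_trans[OF fg(2,4)] unfolding cdg_isomorphic_def by metis
qed

text \<open>Values off the carriers are arbitrary, so maps that are equal as morphisms need not be equal as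
  functions; the zero homotopy identifies them.\<close>

lemma homotopic_cong:
  assumes "cdg_module R L" "cdg_module R M"
    and "\<And>n x. x \<in> carrier (mcomp L n) \<Longrightarrow> g n x \<in> carrier (mcomp M n)"
    and "\<And>n x. x \<in> carrier (mcomp L n) \<Longrightarrow> f n x = g n x"
  shows "homotopic R L M f g"
proof -
  interpret L: cdg_module R L by fact
  interpret M: cdg_module R M by fact
  have "hom_deg R (- 1) L M (\<lambda>n x. \<one>\<^bsub>mcomp M (n - 1)\<^esub>)"
    by (auto simp: hom_deg_def graded_hom_def shift_def hom_def group.is_monoid algebra_simps M.act_one_right)
  moreover have "f n x \<otimes>\<^bsub>mcomp M n\<^esub> inv\<^bsub>mcomp M n\<^esub> (g n x) =
     hom_diff (- 1) L M (\<lambda>n x. \<one>\<^bsub>mcomp M (n - 1)\<^esub>) n x" if "x \<in> carrier (mcomp L n)" for n x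
    using that assms by (simp add: hom_diff_def M.mdiff_one group.is_monoid monoid.inv_one group.r_inv)
  ultimately show ?thesis unfolding homotopic_def by blast
qed

lemma cdg_iso_imp_hot_iso:
  assumes "cdg_module R L" "cdg_module R M" "cdg_hom R L M f"
    and bij: "\<And>n. bij_betw (f n) (carrier (mcomp L n)) (carrier (mcomp M n))"
  shows "hot_iso R L M f"
proof -
  interpret cdg_morphism R L M f by (intro cdg_morphismI assms)
  let ?g = "\<lambda>n. inv_into (carrier (mcomp L n)) (f n)"
  have "homotopic R L L (comp_map ?g f) id_map" "homotopic R M M (comp_map f ?g) id_map"
    using bij_betw_inv_into_left[OF bij] bij_betw_inv_into_right[OF bij]
    by (auto intro!: homotopic_cong assms simp: comp_map_def id_map_def)
  then show ?thesis using cdg_hom_inverse[OF bij] cdg_hom unfolding hot_iso_def by blast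
qed

lemma cdg_isomorphic_imp_hot_isomorphic:
  assumes "cdg_module R L" "cdg_module R M" "cdg_isomorphic R L M"
  shows "hot_isomorphic R L M"
  using assms cdg_iso_imp_hot_iso unfolding cdg_isomorphic_def hot_isomorphic_def by blast

section \<open>Direct sums\<close>

lemma direct_sum_simps [simp]:
  "mcomp (direct_sum I X) n = sum_group I (\<lambda>i. mcomp (X i) n)"
  "act (direct_sum I X) m n r x = (\<lambda>i\<in>I. act (X i) m n r (x i))"
  "mdiff (direct_sum I X) n x = (\<lambda>i\<in>I. mdiff (X i) n (x i))"
  by (simp_all add: direct_sum_def)

text \<open>A map applied to every coordinate does not enlarge the support if it preserves zero.\<close>

lemma sum_group_map_closed:
  assumes "\<And>i. i \<in> I \<Longrightarrow> group (G i)" "\<And>i. i \<in> I \<Longrightarrow> group (H i)" "x \<in> carrier (sum_group I G)"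
    and "\<And>i. i \<in> I \<Longrightarrow> \<phi> i (x i) \<in> carrier (H i)"
    and "\<And>i. i \<in> I \<Longrightarrow> \<phi> i \<one>\<^bsub>G i\<^esub> = \<one>\<^bsub>H i\<^esub>"
  shows "(\<lambda>i\<in>I. \<phi> i (x i)) \<in> carrier (sum_group I H)"
proof -
  have "finite {i \<in> I. x i \<noteq> \<one>\<^bsub>G i\<^esub>}" using assms(1,3) by (simp add: carrier_sum_group)
  then have "finite {i \<in> I. \<phi> i (x i) \<noteq> \<one>\<^bsub>H i\<^esub>}" 
    by (rule rev_finite_subset) (use assms(5) in auto)
  then show ?thesis using assms by (auto simp: carrier_sum_group conj_commute cong: rev_conj_cong)
qed

lemma sum_group_component:
  assumes "\<And>i. i \<in> I \<Longrightarrow> group (G i)" "x \<in> carrier (sum_group I G)" "i \<in> I"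
  shows "x i \<in> carrier (G i)"
  using assms by (auto simp: carrier_sum_group)

lemma cdg_module_direct_sum:
  assumes R: "cdg_ring R" and X: "\<And>i. i \<in> I \<Longrightarrow> cdg_module R (X i)"
  shows "cdg_module R (direct_sum I X)"
proof -
  note [simp] = cdg_module.mcomp_group[OF X] cdg_module.act_one_right[OF X] cdg_module.mdiff_one[OF X]
    cdg_module.act_closed[OF X] cdg_module.mdiff_closed[OF X]
  let ?G = "\<lambda>n. sum_group I (\<lambda>i. mcomp (X i) n)"
  have comp: "x i \<in> carrier (mcomp (X i) n)" if "x \<in> carrier (?G n)" "i \<in> I" for x n i
    using sum_group_component[OF _ that] by simp
  have act [simp]: "(\<lambda>i\<in>I. act (X i) m n r (x i)) \<in> carrier (?G k)"
    if "x \<in> carrier (?G n)" "r \<in> carrier (rcomp R m)" "k = m + n" for m n r x k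
    using that comp[OF that(1)] by (intro sum_group_map_closed[of I "\<lambda>i. mcomp (X i) n"]) auto
  have diff [simp]: "(\<lambda>i\<in>I. mdiff (X i) n (x i)) \<in> carrier (?G k)"
    if "x \<in> carrier (?G n)" "k = n + 1" for n x k
    using that comp[OF that(1)] by (intro sum_group_map_closed[of I "\<lambda>i. mcomp (X i) n"]) auto
  have grp: "group (?G n)" for n by simp
  have sgn: "sgn_pow (?G n) k x = (\<lambda>i\<in>I. sgn_pow (mcomp (X i) n) k (x i))" if "x \<in> carrier (?G n)" for n k x
  proof (cases "even k")
    case True
    have "restrict x I = x" using that by (simp add: carrier_sum_group extensional_restrict PiE_iff)
    with True show ?thesis by (simp add: sgn_pow_def)
  qed (use that in \<open>simp add: sgn_pow_def\<close>)
  show ?thesis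
  proof (intro cdg_module.intro[OF R] cdg_module_axioms.intro, goal_cases)
    case (1 n)
    have "x i \<otimes>\<^bsub>mcomp (X i) n\<^esub> y i = y i \<otimes>\<^bsub>mcomp (X i) n\<^esub> x i"
      if "x \<in> carrier (?G n)" "y \<in> carrier (?G n)" "i \<in> I" for x y i
    proof -
      interpret comm_group "mcomp (X i) n" by (rule cdg_module.mcomp_comm_group[OF X[OF that(3)]])
      show ?thesis using comp[OF that(1,3)] comp[OF that(2,3)] by (rule m_comm)
    qed
    then show ?case by (auto intro!: group.group_comm_groupI[OF grp] restrict_ext)
  next
    case (2 x n m)
    with comp[OF 2[simplified]] show ?case
      by (auto intro!: homI restrict_ext simp: cdg_module.act_mult_left[OF X])
  next
    case (3 r m n)
    have "act (X i) m n r (x i \<otimes>\<^bsub>mcomp (X i) n\<^esub> y i) =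
        act (X i) m n r (x i) \<otimes>\<^bsub>mcomp (X i) (m + n)\<^esub> act (X i) m n r (y i)"
      if "x \<in> carrier (?G n)" "y \<in> carrier (?G n)" "i \<in> I" for x y i
      using that 3 comp[OF that(1,3)] comp[OF that(2,3)] by (intro cdg_module.act_mult_right[OF X]) auto
    with 3 show ?case by (auto intro!: homI restrict_ext)
  next
    case (4 r m s n x k)
    with comp[OF 4(3)[simplified]] show ?case
      by (auto intro!: restrict_ext simp: cdg_module.act_act[OF X])
  next
    case (5 x n)
    then have "restrict x I = x" by (simp add: carrier_sum_group extensional_restrict PiE_iff)
    moreover from 5 comp[OF 5[simplified]] have "act (direct_sum I X) 0 n (runit R) x = restrict x I"
      by (auto intro!: restrict_ext simp: cdg_module.act_unit[OF X])
    ultimately show ?case by simp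
  next
    case (6 n)
    have "mdiff (X i) n (x i \<otimes>\<^bsub>mcomp (X i) n\<^esub> y i) =
        mdiff (X i) n (x i) \<otimes>\<^bsub>mcomp (X i) (n + 1)\<^esub> mdiff (X i) n (y i)"
      if "x \<in> carrier (?G n)" "y \<in> carrier (?G n)" "i \<in> I" for x y i
      using that comp[OF that(1,3)] comp[OF that(2,3)] by (intro cdg_module.mdiff_mult[OF X]) auto
    then show ?case by (auto intro!: homI restrict_ext)
  next
    case (7 r m x n)
    have "(\<lambda>i\<in>I. act (X i) m (n + 1) r ((\<lambda>i\<in>I. mdiff (X i) n (x i)) i)) \<in> carrier (?G (m + n + 1))"
      using 7 by (intro act diff) auto
    from sgn[OF this] 7 comp[OF 7(2)[simplified]] show ?case
      by (auto intro!: restrict_ext simp: cdg_module.mdiff_act[OF X])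
  next
    case (8 x n)
    with comp[OF 8[simplified]] show ?case by (auto intro!: restrict_ext simp: cdg_module.mdiff_twice[OF X])
  qed
qed

section \<open>Copies of cones and direct sums within one type\<close>

text \<open>The subcategories under consideration consist of modules over one type, while cones and direct sums
  live over product and function types; an injection of carriers brings them back.\<close>

lemma ex_small_copy:
  fixes M :: "('r, 'v) cdg_module"
  assumes "cdg_module R M"
    and "\<And>n. \<exists>e :: 'v \<Rightarrow> 'u. inj_on e (carrier (mcomp M n))"
  obtains C :: "('r, 'u) cdg_module" where "cdg_module R C" "cdg_isomorphic R C M"
proof -
  obtain e :: "int \<Rightarrow> 'v \<Rightarrow> 'u" where "\<And>n. inj_on (e n) (carrier (mcomp M n))"
    using assms(2) by metis
  with that[of "transport e M"] show ?thesis
    using assms(1) cdg_module_transport cdg_isomorphic_transport cdg_isomorphic_sym by blast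
qed

lemma ex_inj_prod:
  assumes "infinite (UNIV :: 'u set)"
  shows "\<exists>q :: 'u \<times> 'u \<Rightarrow> 'u. inj q"
  using card_of_Times_same_infinite[OF assms] card_of_ordLeq[of "UNIV :: ('u \<times> 'u) set" "UNIV :: 'u set"]
  by (simp add: ordIso_iff_ordLeq)

text \<open>A pairing function encodes lists recursively, with two distinct tags separating the empty list from
  the others.\<close>

lemma ex_inj_list:
  assumes "infinite (UNIV :: 'u set)"
  shows "\<exists>e :: 'u list \<Rightarrow> 'u. inj e"
proof -
  obtain q :: "'u \<times> 'u \<Rightarrow> 'u" where q: "inj q" using ex_inj_prod[OF assms] by blast
  obtain a b :: 'u where ab: "a \<noteq> b"
    using assms by (metis (full_types) UNIV_I finite.simps finite_subset insertI1 subsetI singletonI)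
  define enc where "enc = rec_list (q (a, a)) (\<lambda>x _ y. q (b, q (x, y)))"
  have [simp]: "enc [] = q (a, a)" "enc (x # xs) = q (b, q (x, enc xs))" for x xs
    by (simp_all add: enc_def)
  have "enc xs = enc ys \<Longrightarrow> xs = ys" for xs ys
  proof (induction xs arbitrary: ys)
    case Nil
    then show ?case using ab by (cases ys) (auto dest: injD[OF q])
  next
    case (Cons x xs)
    then show ?case using ab by (cases ys) (auto dest!: injD[OF q])
  qed
  then show ?thesis by (intro exI[of _ enc] injI)
qed

text \<open>Such a function is determined by its values up to the point after which it agrees with \<open>d\<close>, hence
  by a list.  Elements of a direct sum are of this kind, \<open>d\<close> being the family of zeros.\<close>

lemma ex_inj_eventually_equal:
  fixes d :: "nat \<Rightarrow> 'u"
  assumes "infinite (UNIV :: 'u set)"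
  shows "\<exists>e :: (nat \<Rightarrow> 'u) \<Rightarrow> 'u. inj_on e {x. finite {k. x k \<noteq> d k}}"
proof -
  obtain e :: "'u list \<Rightarrow> 'u" where e: "inj e" using ex_inj_list[OF assms] by blast
  define N where "N x = (LEAST N. \<forall>k\<ge>N. x k = d k)" for x
  have N: "x k = d k" if fin: "finite {k. x k \<noteq> d k}" and "k \<ge> N x" for x k
  proof -
    obtain m where "\<forall>k \<in> {k. x k \<noteq> d k}. k < m"
      using fin by (meson finite_nat_set_iff_bounded)
    then have "\<forall>k\<ge>m. x k = d k" by (meson leD mem_Collect_eq)
    then have "\<forall>k\<ge>N x. x k = d k" unfolding N_def by (rule LeastI)
    with that show ?thesis by blast
  qed
  let ?l = "\<lambda>x. map x [0..<N x]"
  have "inj_on ?l {x. finite {k. x k \<noteq> d k}}"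
  proof (rule inj_onI, rule ext)
    fix x y k assume *: "x \<in> {x. finite {k. x k \<noteq> d k}}" "y \<in> {x. finite {k. x k \<noteq> d k}}" "?l x = ?l y"
    then have "length (?l x) = length (?l y)" by simp
    then have "N x = N y" by simp
    then show "x k = y k"
      using * N[of x k] N[of y k] by (cases "k < N x") auto
  qed
  then have "inj_on (e \<circ> ?l) {x. finite {k. x k \<noteq> d k}}"
    using e by (meson comp_inj_on inj_on_subset subset_UNIV)
  then show ?thesis by blast
qed

lemma ex_small_direct_sum:
  fixes X :: "nat \<Rightarrow> ('r, 'u) cdg_module"
  assumes inf: "infinite (UNIV :: 'u set)" and R: "cdg_ring R" and X: "\<And>i. i \<in> I \<Longrightarrow> cdg_module R (X i)"
  obtains P :: "('r, 'u) cdg_module" where "cdg_module R P" "cdg_isomorphic R P (direct_sum I X)"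
proof (rule ex_small_copy[OF cdg_module_direct_sum[OF R X]])
  fix n
  let ?d = "\<lambda>i\<in>I. \<one>\<^bsub>mcomp (X i) n\<^esub>"
  have "finite {k. x k \<noteq> ?d k}" if x: "x \<in> carrier (mcomp (direct_sum I X) n)" for x
  proof -
    have "finite {i \<in> I. x i \<noteq> \<one>\<^bsub>mcomp (X i) n\<^esub>}" "x \<in> extensional I"
      using x cdg_module.mcomp_group[OF X] by (auto simp: carrier_sum_group PiE_iff)
    moreover from this(2) have "{k. x k \<noteq> ?d k} = {i \<in> I. x i \<noteq> \<one>\<^bsub>mcomp (X i) n\<^esub>}"
      by (auto simp: extensional_def restrict_def)
    ultimately show ?thesis by simp
  qed
  then have sub: "carrier (mcomp (direct_sum I X) n) \<subseteq> {x. finite {k. x k \<noteq> ?d k}}" by blast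
  obtain e :: "(nat \<Rightarrow> 'u) \<Rightarrow> 'u" where "inj_on e {x. finite {k. x k \<noteq> ?d k}}"
    using ex_inj_eventually_equal[OF inf] by blast
  then show "\<exists>e :: (nat \<Rightarrow> 'u) \<Rightarrow> 'u. inj_on e (carrier (mcomp (direct_sum I X) n))"
    using sub inj_on_subset by blast
qed (use X that in auto)

section \<open>Cones and short exact sequences in a triangulated subcategory\<close>

context cdg_morphism
begin

lemma ex_small_cone:
  assumes inf: "infinite (UNIV :: 'u set)"
    and "\<exists>g :: 'a \<Rightarrow> 'u. inj g" "\<exists>h :: 'b \<Rightarrow> 'u. inj h"
  obtains C :: "('r, 'u) cdg_module" where "cdg_module R C" "cdg_isomorphic R C (cone L M f)"
proof (rule ex_small_copy[OF cdg_module_cone])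
  obtain q :: "'u \<times> 'u \<Rightarrow> 'u" where q: "inj q" using ex_inj_prod[OF inf] by blast
  obtain g :: "'a \<Rightarrow> 'u" and h :: "'b \<Rightarrow> 'u" where "inj g" "inj h" using assms by blast
  with q have "inj (q \<circ> map_prod h g)" by (simp add: inj_compose prod.inj_map)
  then show "\<exists>e. inj_on (e :: 'b \<times> 'a \<Rightarrow> 'u) (carrier (mcomp (cone L M f) n))" for n
    by (meson inj_on_subset subset_UNIV)
qed (use that in auto)

lemma cdg_hom_cone_incl: "cdg_hom R M (cone L M f) (cone_incl L)"
  by (rule cdg_homI)
    (auto simp: cone_incl_def dom.module_simps cod.module_simps map_simps
      group.is_monoid monoid.inv_one add_ac)

lemma cdg_hom_cone_proj: "cdg_hom R (cone L M f) (shift 1 L) cone_proj"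
  by (rule cdg_homI)
    (auto simp: cone_proj_def shift_def sgn_pow_def add_ac)

end

lemma distinguished_cone:
  fixes A B C :: "('r, 'u) cdg_module"
  assumes "cdg_module R A" "cdg_module R B" "cdg_hom R A B f" "cdg_module R C"
    and iso: "cdg_isomorphic R C (cone A B f)"
  shows "\<exists>v w. distinguished R A B C f v w"
proof -
  interpret cdg_morphism R A B f by (intro cdg_morphismI assms)
  obtain c where c: "cdg_hom R C (cone A B f) c"
    and bij: "\<And>n. bij_betw (c n) (carrier (mcomp C n)) (carrier (mcomp (cone A B f) n))"
    using iso by (auto simp: cdg_isomorphic_def)
  interpret c: cdg_morphism R C "cone A B f" c by (intro cdg_morphismI assms cdg_module_cone c)
  let ?g = "\<lambda>n. inv_into (carrier (mcomp C n)) (c n)"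
  let ?v = "comp_map ?g (cone_incl A)" and ?w = "comp_map cone_proj c"
  have id: "hot_iso R X X id_map" if "cdg_module R X" for X :: "('r, 'u) cdg_module"
    by (rule cdg_iso_imp_hot_iso[OF that that cdg_hom_id]) (simp add: id_map_def bij_betw_def inj_on_def)
  have cg: "c n (?g n x) = x" if "x \<in> carrier (mcomp (cone A B f) n)" for n x
    using bij_betw_inv_into_right[OF bij] that by simp
  have incl: "cone_incl A n y \<in> carrier (mcomp (cone A B f) n)" if "y \<in> carrier (mcomp B n)" for n y
    using that by (simp add: cone_incl_def)
  have v: "cdg_hom R B C ?v"
    using cdg_hom_comp[OF cdg_hom_cone_incl c.cdg_hom_inverse[OF bij]] .
  have w: "cdg_hom R C (shift 1 A) ?w"
    using cdg_hom_comp[OF c cdg_hom_cone_proj] .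
  interpret w: cdg_morphism R C "shift 1 A" ?w
    by (intro cdg_morphismI assms cdg_module_shift w)
  have "homotopic R A B (comp_map id_map f) (comp_map f id_map)"
    by (rule homotopic_cong) (auto simp: assms comp_map_def id_map_def)
  moreover have "homotopic R B (cone A B f) (comp_map c ?v) (comp_map (cone_incl A) id_map)"
    using incl cg by (intro homotopic_cong assms cdg_module_cone) (auto simp: comp_map_def id_map_def)
  moreover have "homotopic R C (shift 1 A) (comp_map (shift_map 1 id_map) ?w) (comp_map cone_proj c)"
    by (intro homotopic_cong assms cdg_module_shift w.map_closed) (auto simp: comp_map_def id_map_def shift_map_def)
  ultimately show ?thesis
    unfolding distinguished_def
    using assms v w id[OF assms(1)] id[OF assms(2)] cdg_iso_imp_hot_iso[OF assms(4) cdg_module_cone c bij]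
    by blast
qed

text \<open>The hypothesis allows any module isomorphic to the cone, because the cone itself is a module over
  another type than \<open>A\<close> and \<open>B\<close>.\<close>

lemma two_of_three_cone:
  fixes A B C :: "('r, 'u) cdg_module"
  assumes S: "full_triangulated_subcategory R S"
    and "cdg_module R A" "cdg_module R B" "cdg_hom R A B f" "cdg_module R C"
      "cdg_isomorphic R C (cone A B f)"
  shows "A \<in> S \<Longrightarrow> B \<in> S \<Longrightarrow> C \<in> S" "B \<in> S \<Longrightarrow> C \<in> S \<Longrightarrow> A \<in> S" "A \<in> S \<Longrightarrow> C \<in> S \<Longrightarrow> B \<in> S"
  using S distinguished_cone[OF assms(2-6)] unfolding full_triangulated_subcategory_def by blast+

text \<open>A totalization is defined as the cone of a map out of a cone; this replaces the inner cone by a copy.\<close>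

lemma cone_cong:
  assumes "cdg_module R C" "cdg_module R D" "cdg_module R M" "cdg_hom R C D c"
    and bij: "\<And>n. bij_betw (c n) (carrier (mcomp C n)) (carrier (mcomp D n))"
    and p: "cdg_hom R D M p"
  shows "cdg_isomorphic R (cone C M (comp_map p c)) (cone D M p)"
proof -
  interpret cdg_morphism R C D c by (intro cdg_morphismI assms)
  let ?h = "\<lambda>n. map_prod id (c (n + 1))"
  have inv: "c n (inv\<^bsub>mcomp C n\<^esub> x) = inv\<^bsub>mcomp D n\<^esub> c n x" if "x \<in> carrier (mcomp C n)" for n x
    using map_sgn_pow[OF that, of n 1] by (simp add: sgn_pow_def)
  have "cdg_hom R (cone C M (comp_map p c)) (cone D M p) ?h"
    by (rule cdg_homI) (auto simp: map_simps inv comp_map_def add_ac)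
  moreover have "bij_betw (?h n) (carrier (mcomp (cone C M (comp_map p c)) n)) (carrier (mcomp (cone D M p) n))" for n
    using bij by (auto intro!: bij_betw_map_prod)
  ultimately show ?thesis unfolding cdg_isomorphic_def by blast
qed

text \<open>Let \<open>C\<close> be a copy of the cone of \<open>i\<close>.  The map \<open>p\<close> induces \<open>C \<rightarrow> M\<close> with cone a copy of the
  totalization, which lies in \<open>S\<close>; hence \<open>C\<close> is in \<open>S\<close> as soon as \<open>M\<close> is, and conversely.  The triangle on
  \<open>K \<rightarrow> L \<rightarrow> C\<close> then relates \<open>K\<close>, \<open>L\<close> and \<open>M\<close>.\<close>

lemma short_exact_in_triangulated:
  fixes K L M :: "('r, 'u) cdg_module"
  assumes inf: "infinite (UNIV :: 'u set)"
    and S: "full_triangulated_subcategory R S" and Tot: "totalizations R \<subseteq> S"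
    and ex: "cdg_short_exact R K L M i p"
  shows "K \<in> S \<Longrightarrow> L \<in> S \<Longrightarrow> M \<in> S" "K \<in> S \<Longrightarrow> M \<in> S \<Longrightarrow> L \<in> S"
proof -
  have mods: "cdg_module R K" "cdg_module R L" "cdg_module R M" "cdg_hom R K L i" "cdg_hom R L M p"
    using ex by (auto simp: cdg_short_exact_def)
  interpret i: cdg_morphism R K L i by (intro cdg_morphismI mods)
  interpret p: cdg_morphism R L M p by (intro cdg_morphismI mods)
  have pi [simp]: "p n (i n x) = \<one>\<^bsub>mcomp M n\<^esub>" if "x \<in> carrier (mcomp K n)" for n x
    using ex that by (auto simp: cdg_short_exact_def kernel_def)
  have inj: "\<exists>g :: 'u \<Rightarrow> 'u. inj g" using inj_on_id by blast
  obtain C :: "('r, 'u) cdg_module" where C: "cdg_module R C" "cdg_isomorphic R C (cone K L i)"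
    using i.ex_small_cone[OF inf inj inj] by blast
  obtain c where c: "cdg_hom R C (cone K L i) c"
    and bij: "\<And>n. bij_betw (c n) (carrier (mcomp C n)) (carrier (mcomp (cone K L i) n))"
    using C by (auto simp: cdg_isomorphic_def)
  let ?p = "\<lambda>n (l, k). p n l"
  have p': "cdg_hom R (cone K L i) M ?p"
    by (rule cdg_homI) (auto simp: p.map_simps p.cod.mcomp_group group.is_monoid)
  let ?q = "comp_map ?p c"
  have q: "cdg_hom R C M ?q" by (rule cdg_hom_comp[OF c p'])
  interpret q: cdg_morphism R C M ?q by (intro cdg_morphismI C mods q)
  obtain Z :: "('r, 'u) cdg_module" where Z: "cdg_module R Z" "cdg_isomorphic R Z (cone C M ?q)"
    using q.ex_small_cone[OF inf inj inj] by blast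
  have "cdg_isomorphic R Z (Tot K L M i p)"
    using cdg_isomorphic_trans[OF Z(2) cone_cong[OF C(1) i.cdg_module_cone mods(3) c bij p']]
    by (simp add: Tot_def)
  then have "Z \<in> S" using Tot Z(1) ex unfolding totalizations_def by blast
  moreover note tri = two_of_three_cone[OF S mods(1,2,4) C] two_of_three_cone[OF S C(1) mods(3) q Z]
  ultimately show "K \<in> S \<Longrightarrow> L \<in> S \<Longrightarrow> M \<in> S" "K \<in> S \<Longrightarrow> M \<in> S \<Longrightarrow> L \<in> S" by blast+
qed

section \<open>The telescope of an exhausting sequence of submodules\<close>

text \<open>Applied to the differential and to the action of a ring element, this shows that total sums commute
  with them.\<close>

lemma (in comm_group) finprod_hom:
  assumes "comm_group H" "h \<in> hom G H" "\<And>k. x k \<in> carrier G"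
  shows "h (finprod G x {..K::nat}) = finprod H (\<lambda>k. h (x k)) {..K}"
proof -
  interpret H: comm_group H by fact
  have [simp]: "h y \<in> carrier H" if "y \<in> carrier G" for y
    using assms(2) that by (auto simp: hom_def)
  show ?thesis
    using assms(2,3) by (induction K) (simp_all add: hom_mult Pi_iff)
qed

text \<open>The index set is the support and not all of \<open>nat\<close>, since \<open>finprod\<close> over an infinite set is the unit
  by convention.\<close>

definition total_sum :: "('a, 'm) monoid_scheme \<Rightarrow> (nat \<Rightarrow> 'a) \<Rightarrow> 'a" where
  "total_sum G x = finprod G x {k. x k \<noteq> \<one>\<^bsub>G\<^esub>}"

text \<open>Additively this is \<open>x\<^sub>k - x\<^sub>k\<^sub>-\<^sub>1\<close> with \<open>x\<^sub>-\<^sub>1 = 0\<close>, the identity minus the shift of sequences.\<close>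

definition telescope :: "('a, 'm) monoid_scheme \<Rightarrow> (nat \<Rightarrow> 'a) \<Rightarrow> nat \<Rightarrow> 'a" where
  "telescope G x k = (case k of 0 \<Rightarrow> x 0 | Suc j \<Rightarrow> x (Suc j) \<otimes>\<^bsub>G\<^esub> inv\<^bsub>G\<^esub> (x j))"

lemma telescope_simps [simp]:
  "telescope G x 0 = x 0" "telescope G x (Suc j) = x (Suc j) \<otimes>\<^bsub>G\<^esub> inv\<^bsub>G\<^esub> (x j)"
  by (simp_all add: telescope_def)

context comm_group
begin

lemma total_sum_eq_finprod:
  assumes "\<And>k. x k \<in> carrier G" "\<And>k. k > K \<Longrightarrow> x k = \<one>"
  shows "total_sum G x = finprod G x {..K}"
  unfolding total_sum_def
  by (rule finprod_mono_neutral_cong_left) (use assms in \<open>auto simp: not_less[symmetric]\<close>)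

lemma telescope_closed:
  assumes "\<And>k. x k \<in> carrier G"
  shows "telescope G x k \<in> carrier G"
  using assms by (cases k) auto

text \<open>On sequences of arbitrary support the telescope map is bijective: this lemma and the next one show
  that the formation of partial sums is its inverse.\<close>

lemma finprod_telescope:
  assumes "\<And>k. x k \<in> carrier G"
  shows "finprod G (telescope G x) {..K} = x K"
proof (induction K)
  case (Suc K)
  then show ?case using assms telescope_closed[OF assms] by (simp add: Pi_iff m_assoc)
qed (use assms in simp)

lemma telescope_finprod:
  assumes "\<And>k. x k \<in> carrier G"
  shows "telescope G (\<lambda>k. finprod G x {..k}) = x"
proof
  fix k show "telescope G (\<lambda>k. finprod G x {..k}) k = x k"
    using assms by (cases k) (simp_all add: Pi_iff m_assoc)
qed

end

lemma ex_bound_of_finite: "finite {k. P k} \<Longrightarrow> \<exists>K::nat. \<forall>k>K. \<not> P k"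
  using finite_nat_set_iff_bounded_le by (metis mem_Collect_eq not_less)

text \<open>The colimit of the sequence of the \<open>N k\<close> is \<open>M\<close>.  The locale constructs the exact sequence
  \<open>0 \<rightarrow> \<Oplus>N k \<rightarrow> \<Oplus>N k \<rightarrow> M \<rightarrow> 0\<close> which presents it.\<close>

locale exhausted_module = cdg_module R M for R :: "'r cdg_ring" and M :: "('r, 'u) cdg_module" +
  fixes N :: "nat \<Rightarrow> int \<Rightarrow> 'u set"
  assumes submodule: "cdg_submodule R (N k) M"
    and increasing: "N k n \<subseteq> N (Suc k) n"
    and exhausting: "carrier (mcomp M n) = (\<Union>k. N k n)"
begin

definition "layer_sum = direct_sum UNIV (\<lambda>k. restrict_module M (N k))"

lemma layer_sum_simps [simp]:
  "x \<otimes>\<^bsub>mcomp layer_sum n\<^esub> y = (\<lambda>k. x k \<otimes>\<^bsub>mcomp M n\<^esub> y k)"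
  "act layer_sum m n r x = (\<lambda>k. act M m n r (x k))"
  "mdiff layer_sum n x = (\<lambda>k. mdiff M n (x k))"
  by (simp_all add: layer_sum_def restrict_def)

lemma sub: "subgroup (N k n) (mcomp M n)"
  using submodule by (simp add: cdg_submodule_def)

lemma cdg_module_sum: "cdg_module R layer_sum"
  unfolding layer_sum_def using cdg_module_direct_sum[OF cdg_ring_axioms] cdg_module_restrict_module[OF cdg_module_axioms submodule] .

lemma carrier_sum:
  "x \<in> carrier (mcomp layer_sum n) \<longleftrightarrow> (\<forall>k. x k \<in> N k n) \<and> finite {k. x k \<noteq> \<one>\<^bsub>mcomp M n\<^esub>}"
  using subgroup.subgroup_is_group[OF sub mcomp_group]
  by (auto simp: layer_sum_def carrier_sum_group PiE_iff)

lemma in_carrier: "x \<in> N k n \<Longrightarrow> x \<in> carrier (mcomp M n)"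
  using subgroup.subset[OF sub] by blast

lemma component: "x \<in> carrier (mcomp layer_sum n) \<Longrightarrow> x k \<in> carrier (mcomp M n)"
  using carrier_sum in_carrier by blast

lemma bound:
  assumes "x \<in> carrier (mcomp layer_sum n)"
  obtains K where "\<And>k. k > K \<Longrightarrow> x k = \<one>\<^bsub>mcomp M n\<^esub>"
  using assms ex_bound_of_finite[of "\<lambda>k. x k \<noteq> \<one>\<^bsub>mcomp M n\<^esub>"] by (auto simp: carrier_sum)

lemma bounded_in_sum:
  assumes "\<And>k. x k \<in> N k n" "\<And>k. k > K \<Longrightarrow> x k = \<one>\<^bsub>mcomp M n\<^esub>"
  shows "x \<in> carrier (mcomp layer_sum n)"
proof -
  have "{k. x k \<noteq> \<one>\<^bsub>mcomp M n\<^esub>} \<subseteq> {..K}" using assms(2) by (auto simp: not_less[symmetric])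
  then show ?thesis using assms(1) finite_subset by (auto simp: carrier_sum)
qed

text \<open>The telescope map stays in the direct sum because \<open>N (k - 1) \<subseteq> N k\<close>.\<close>

lemma cdg_hom_telescope: "cdg_hom R layer_sum layer_sum (\<lambda>n. telescope (mcomp M n))"
proof (rule cdg_homI)
  fix n x assume x: "x \<in> carrier (mcomp layer_sum n)"
  interpret G: comm_group "mcomp M n" by (rule mcomp_comm_group)
  obtain K where K: "\<And>k. k > K \<Longrightarrow> x k = \<one>\<^bsub>mcomp M n\<^esub>" using bound[OF x] by blast
  have xN: "x k \<in> N k n" for k using x by (simp add: carrier_sum)
  show "telescope (mcomp M n) x \<in> carrier (mcomp layer_sum n)"
  proof (rule bounded_in_sum)
    fix k show "telescope (mcomp M n) x k \<in> N k n"
    proof (cases k)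
      case (Suc j)
      then show ?thesis
        using xN increasing by (auto intro!: subgroup.m_closed[OF sub] subgroup.m_inv_closed[OF sub])
    qed (simp add: xN)
    show "telescope (mcomp M n) x k = \<one>\<^bsub>mcomp M n\<^esub>" if "k > Suc K"
      using that K by (cases k) auto
  qed
  show "telescope (mcomp M (n + 1)) (mdiff layer_sum n x) = mdiff layer_sum n (telescope (mcomp M n) x)"
  proof
    fix k show "telescope (mcomp M (n + 1)) (mdiff layer_sum n x) k = mdiff layer_sum n (telescope (mcomp M n) x) k"
      using component[OF x] by (cases k) (simp_all add: inv_eq_sgn_pow module_simps)
  qed
next
  fix n x y assume x: "x \<in> carrier (mcomp layer_sum n)" and y: "y \<in> carrier (mcomp layer_sum n)"
  interpret G: comm_group "mcomp M n" by (rule mcomp_comm_group)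
  show "telescope (mcomp M n) (x \<otimes>\<^bsub>mcomp layer_sum n\<^esub> y) =
      telescope (mcomp M n) x \<otimes>\<^bsub>mcomp layer_sum n\<^esub> telescope (mcomp M n) y" (is "?l = ?r")
  proof
    fix k show "?l k = ?r k"
      using component[OF x] component[OF y] by (cases k) (simp_all add: G.inv_mult G.mult_swap4)
  qed
next
  fix m n r x assume r: "r \<in> carrier (rcomp R m)" and x: "x \<in> carrier (mcomp layer_sum n)"
  show "telescope (mcomp M (m + n)) (act layer_sum m n r x) = act layer_sum m n r (telescope (mcomp M n) x)" (is "?l = ?r")
  proof
    fix k show "?l k = ?r k"
      using component[OF x] r by (cases k) (simp_all add: inv_eq_sgn_pow module_simps)
  qed
qed

lemma cdg_hom_total_sum: "cdg_hom R layer_sum M (\<lambda>n. total_sum (mcomp M n))"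
proof (rule cdg_homI)
  fix n x assume x: "x \<in> carrier (mcomp layer_sum n)"
  interpret G: comm_group "mcomp M n" by (rule mcomp_comm_group)
  interpret G': comm_group "mcomp M (n + 1)" by (rule mcomp_comm_group)
  obtain K where K: "\<And>k. k > K \<Longrightarrow> x k = \<one>\<^bsub>mcomp M n\<^esub>" using bound[OF x] by blast
  have tot: "total_sum (mcomp M n) x = finprod (mcomp M n) x {..K}"
    by (rule G.total_sum_eq_finprod) (use component[OF x] K in auto)
  show "total_sum (mcomp M n) x \<in> carrier (mcomp M n)"
    unfolding tot using component[OF x] by (simp add: Pi_iff)
  have "total_sum (mcomp M (n + 1)) (mdiff layer_sum n x) = finprod (mcomp M (n + 1)) (mdiff layer_sum n x) {..K}"
    by (rule G'.total_sum_eq_finprod) (use component[OF x] K in \<open>auto simp: mdiff_one\<close>)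
  also have "\<dots> = mdiff M n (finprod (mcomp M n) x {..K})"
    using G.finprod_hom[OF G'.comm_group_axioms mdiff_hom component[OF x]] by simp
  finally show "total_sum (mcomp M (n + 1)) (mdiff layer_sum n x) = mdiff M n (total_sum (mcomp M n) x)"
    by (simp only: tot)
next
  fix n x y assume x: "x \<in> carrier (mcomp layer_sum n)" and y: "y \<in> carrier (mcomp layer_sum n)"
  interpret G: comm_group "mcomp M n" by (rule mcomp_comm_group)
  obtain K where K: "\<And>k. k > K \<Longrightarrow> x k = \<one>\<^bsub>mcomp M n\<^esub>" using bound[OF x] by blast
  obtain K' where K': "\<And>k. k > K' \<Longrightarrow> y k = \<one>\<^bsub>mcomp M n\<^esub>" using bound[OF y] by blast
  have "total_sum (mcomp M n) z = finprod (mcomp M n) z {..max K K'}"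
    if "z \<in> {x, y, x \<otimes>\<^bsub>mcomp layer_sum n\<^esub> y}" for z
    by (rule G.total_sum_eq_finprod) (use that component[OF x] component[OF y] K K' in auto)
  then show "total_sum (mcomp M n) (x \<otimes>\<^bsub>mcomp layer_sum n\<^esub> y) = total_sum (mcomp M n) x \<otimes>\<^bsub>mcomp M n\<^esub> total_sum (mcomp M n) y"
    using component[OF x] component[OF y] by (simp add: Pi_iff)
next
  fix m n r x assume r: "r \<in> carrier (rcomp R m)" and x: "x \<in> carrier (mcomp layer_sum n)"
  interpret G: comm_group "mcomp M n" by (rule mcomp_comm_group)
  interpret G': comm_group "mcomp M (m + n)" by (rule mcomp_comm_group)
  obtain K where K: "\<And>k. k > K \<Longrightarrow> x k = \<one>\<^bsub>mcomp M n\<^esub>" using bound[OF x] by blast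
  have tot: "total_sum (mcomp M n) x = finprod (mcomp M n) x {..K}"
    by (rule G.total_sum_eq_finprod) (use component[OF x] K in auto)
  have "total_sum (mcomp M (m + n)) (act layer_sum m n r x) = finprod (mcomp M (m + n)) (act layer_sum m n r x) {..K}"
    by (rule G'.total_sum_eq_finprod) (use component[OF x] K r in \<open>auto simp: act_one_right\<close>)
  also have "\<dots> = act M m n r (finprod (mcomp M n) x {..K})"
    using G.finprod_hom[OF G'.comm_group_axioms act_hom_right[OF r] component[OF x]] by simp
  finally show "total_sum (mcomp M (m + n)) (act layer_sum m n r x) = act M m n r (total_sum (mcomp M n) x)"
    by (simp only: tot)
qed

text \<open>A sequence is recovered from its telescope by partial sums, which gives injectivity.  The total sum
  of a telescope is a late entry of the sequence, hence zero.  If the total sum of \<open>y\<close> is zero, the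
  partial sums of \<open>y\<close> vanish from some index on and lie in the \<open>N k\<close>, so they form an element of the direct
  sum whose telescope is \<open>y\<close>.\<close>

lemma telescope_short_exact:
  "cdg_short_exact R layer_sum layer_sum M (\<lambda>n. telescope (mcomp M n)) (\<lambda>n. total_sum (mcomp M n))"
  unfolding cdg_short_exact_def
proof (intro conjI allI cdg_module_sum cdg_module_axioms cdg_hom_telescope cdg_hom_total_sum)
  fix n
  interpret G: comm_group "mcomp M n" by (rule mcomp_comm_group)
  let ?G = "mcomp M n"
  have tel: "telescope ?G x \<in> carrier (mcomp layer_sum n)" if "x \<in> carrier (mcomp layer_sum n)" for x
    using cdg_hom_telescope that by (auto simp: cdg_hom_def graded_hom_def hom_def)
  show "inj_on (telescope ?G) (carrier (mcomp layer_sum n))"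
  proof (rule inj_onI, rule ext)
    fix x y k assume "x \<in> carrier (mcomp layer_sum n)" "y \<in> carrier (mcomp layer_sum n)" "telescope ?G x = telescope ?G y"
    then show "x k = y k"
      using G.finprod_telescope[of x k] G.finprod_telescope[of y k] component by simp
  qed
  show "telescope ?G ` carrier (mcomp layer_sum n) = kernel (mcomp layer_sum n) ?G (total_sum ?G)"
  proof (intro equalityI subsetI)
    fix y assume "y \<in> telescope ?G ` carrier (mcomp layer_sum n)"
    then obtain x where x: "x \<in> carrier (mcomp layer_sum n)" and y: "y = telescope ?G x" by blast
    obtain K where K: "\<And>k. k > K \<Longrightarrow> x k = \<one>\<^bsub>?G\<^esub>" using bound[OF x] by blast
    have "total_sum ?G y = finprod ?G y {..Suc K}"
      unfolding y
    proof (rule G.total_sum_eq_finprod)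
      fix k show "telescope ?G x k \<in> carrier ?G" by (rule G.telescope_closed[OF component[OF x]])
      show "telescope ?G x k = \<one>\<^bsub>?G\<^esub>" if "k > Suc K" using that K by (cases k) auto
    qed
    also have "\<dots> = \<one>\<^bsub>?G\<^esub>" unfolding y G.finprod_telescope[OF component[OF x]] by (rule K) simp
    finally show "y \<in> kernel (mcomp layer_sum n) ?G (total_sum ?G)" using tel[OF x] y by (simp add: kernel_def)
  next
    fix y assume "y \<in> kernel (mcomp layer_sum n) ?G (total_sum ?G)"
    then have y: "y \<in> carrier (mcomp layer_sum n)" and tot: "total_sum ?G y = \<one>\<^bsub>?G\<^esub>" by (simp_all add: kernel_def)
    obtain K where K: "\<And>k. k > K \<Longrightarrow> y k = \<one>\<^bsub>?G\<^esub>" using bound[OF y] by blast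
    let ?x = "\<lambda>k. finprod ?G y {..k}"
    have yN: "y k \<in> N k n" for k using y by (simp add: carrier_sum)
    have "?x \<in> carrier (mcomp layer_sum n)"
    proof (rule bounded_in_sum)
      fix k
      show "?x k \<in> N k n"
      proof (induction k)
        case (Suc k)
        then show ?case
          using subgroup.m_closed[OF sub yN[of "Suc k"]] increasing component[OF y]
          by (auto simp: Pi_iff)
      qed (use yN component[OF y] in simp)
      show "?x k = \<one>\<^bsub>?G\<^esub>" if "k > K"
        using G.total_sum_eq_finprod[of y k] component[OF y] K that tot by simp
    qed
    then show "y \<in> telescope ?G ` carrier (mcomp layer_sum n)"
      by (intro image_eqI[of y _ ?x] G.telescope_finprod[symmetric] component[OF y])
  qed
  show "total_sum ?G ` carrier (mcomp layer_sum n) = carrier ?G"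
  proof (intro equalityI subsetI)
    fix z assume "z \<in> total_sum ?G ` carrier (mcomp layer_sum n)"
    then show "z \<in> carrier ?G"
      using cdg_hom_total_sum by (auto simp: cdg_hom_def graded_hom_def hom_def)
  next
    fix z assume z: "z \<in> carrier ?G"
    then obtain k where k: "z \<in> N k n" using exhausting by blast
    let ?x = "\<lambda>l. if l = k then z else \<one>\<^bsub>?G\<^esub>"
    have "?x \<in> carrier (mcomp layer_sum n)"
      by (rule bounded_in_sum[of _ _ k]) (use k subgroup.one_closed[OF sub] in auto)
    moreover have "total_sum ?G ?x = z"
    proof (cases "z = \<one>\<^bsub>?G\<^esub>")
      case False
      then have "{l. ?x l \<noteq> \<one>\<^bsub>?G\<^esub>} = {k}" by auto
      then show ?thesis using z by (simp add: total_sum_def)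
    qed (simp add: total_sum_def)
    ultimately show "z \<in> total_sum ?G ` carrier (mcomp layer_sum n)" by (intro image_eqI[of z _ ?x]) simp_all
  qed
qed

end

text \<open>This moves the telescope sequence to a copy of the direct sum over the type of \<open>M\<close>.\<close>

lemma ex_cdg_short_exact_isomorphic:
  assumes ex: "cdg_short_exact R D D M i p" and P: "cdg_module R P" and iso: "cdg_isomorphic R P D"
  shows "\<exists>i' p'. cdg_short_exact R P P M i' p'"
proof -
  have mods: "cdg_module R D" "cdg_module R M" "cdg_hom R D D i" "cdg_hom R D M p"
    and ex': "inj_on (i n) (carrier (mcomp D n))"
      "i n ` carrier (mcomp D n) = kernel (mcomp D n) (mcomp M n) (p n)"
      "p n ` carrier (mcomp D n) = carrier (mcomp M n)" for n
    using ex by (auto simp: cdg_short_exact_def)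
  obtain c where c: "cdg_hom R P D c"
    and bij: "\<And>n. bij_betw (c n) (carrier (mcomp P n)) (carrier (mcomp D n))"
    using iso by (auto simp: cdg_isomorphic_def)
  interpret c: cdg_morphism R P D c by (intro cdg_morphismI P mods c)
  interpret i: cdg_morphism R D D i by (intro cdg_morphismI mods)
  let ?g = "\<lambda>n. inv_into (carrier (mcomp P n)) (c n)"
  let ?i = "comp_map ?g (comp_map i c)" and ?p = "comp_map p c"
  have imc: "c n ` carrier (mcomp P n) = carrier (mcomp D n)" for n
    using bij by (simp add: bij_betw_def)
  have bijg: "bij_betw (?g n) (carrier (mcomp D n)) (carrier (mcomp P n))" for n
    using bij_betw_inv_into[OF bij] .
  have cg: "c n (?g n x) = x" if "x \<in> carrier (mcomp D n)" for n x
    using bij_betw_inv_into_right[OF bij that] .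
  have gc: "?g n (c n x) = x" if "x \<in> carrier (mcomp P n)" for n x
    using bij_betw_inv_into_left[OF bij that] .
  have "cdg_short_exact R P P M ?i ?p"
    unfolding cdg_short_exact_def
  proof (intro conjI allI P mods cdg_hom_comp[OF c mods(4)]
      cdg_hom_comp[OF cdg_hom_comp[OF c mods(3)] c.cdg_hom_inverse[OF bij]])
    fix n
    have eq: "?i n = ?g n \<circ> (i n \<circ> c n)" "?p n = p n \<circ> c n" by (auto simp: comp_map_def)
    show "?p n ` carrier (mcomp P n) = carrier (mcomp M n)"
      unfolding eq image_comp[symmetric] imc ex' ..
    show "inj_on (?i n) (carrier (mcomp P n))"
      unfolding eq
    proof (intro comp_inj_on)
      show "inj_on (c n) (carrier (mcomp P n))" using bij by (simp add: bij_betw_def)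
      show "inj_on (i n) (c n ` carrier (mcomp P n))" unfolding imc by (rule ex')
      have "(i n \<circ> c n) ` carrier (mcomp P n) \<subseteq> carrier (mcomp D n)" by auto
      then show "inj_on (?g n) ((i n \<circ> c n) ` carrier (mcomp P n))"
        using bijg[of n] by (meson bij_betw_def inj_on_subset)
    qed
    have "?i n ` carrier (mcomp P n) = ?g n ` kernel (mcomp D n) (mcomp M n) (p n)"
      unfolding eq image_comp[symmetric] imc ex' ..
    also have "\<dots> = kernel (mcomp P n) (mcomp M n) (?p n)"
    proof (intro equalityI subsetI)
      fix x assume "x \<in> ?g n ` kernel (mcomp D n) (mcomp M n) (p n)"
      then obtain y where y: "y \<in> carrier (mcomp D n)" "p n y = \<one>\<^bsub>mcomp M n\<^esub>" "x = ?g n y"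
        by (auto simp: kernel_def)
      then have "x \<in> carrier (mcomp P n)" using bijg[of n] by (auto simp: bij_betw_def)
      with y show "x \<in> kernel (mcomp P n) (mcomp M n) (?p n)"
        by (simp add: kernel_def comp_map_def cg)
    next
      fix x assume x: "x \<in> kernel (mcomp P n) (mcomp M n) (?p n)"
      then have "c n x \<in> kernel (mcomp D n) (mcomp M n) (p n)" by (auto simp: kernel_def comp_map_def)
      then show "x \<in> ?g n ` kernel (mcomp D n) (mcomp M n) (p n)"
        using gc[of x n] x by (metis (no_types, lifting) imageI kernel_def mem_Collect_eq)
    qed
    finally show "?i n ` carrier (mcomp P n) = kernel (mcomp P n) (mcomp M n) (?p n)" .
  qed
  then show ?thesis by blast
qed

lemma (in exhausted_module) in_triangulated:
  assumes inf: "infinite (UNIV :: 'u set)"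
    and S: "full_triangulated_subcategory R S" and Tot: "totalizations R \<subseteq> S"
    and sums: "closed_under_countable_sums R S"
    and N: "\<And>k. restrict_module M (N k) \<in> S"
  shows "M \<in> S"
proof -
  obtain P :: "('r, 'u) cdg_module" where P: "cdg_module R P" "cdg_isomorphic R P layer_sum"
    unfolding layer_sum_def
    by (rule ex_small_direct_sum[OF inf cdg_ring_axioms, of UNIV "\<lambda>k. restrict_module M (N k)"])
      (use cdg_module_restrict_module[OF cdg_module_axioms submodule] in blast)+
  have "hot_isomorphic R P layer_sum"
    using P cdg_module_sum cdg_isomorphic_imp_hot_isomorphic by blast
  then have "P \<in> S"
    using sums[unfolded closed_under_countable_sums_def, rule_format, of UNIV "\<lambda>k. restrict_module M (N k)" P]
      N P(1) unfolding layer_sum_def by blast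
  moreover obtain i p where "cdg_short_exact R P P M i p"
    using ex_cdg_short_exact_isomorphic[OF telescope_short_exact P] by blast
  ultimately show ?thesis
    using short_exact_in_triangulated(1)[OF inf S Tot] by blast
qed

section \<open>The short exact sequence of a quotient\<close>

text \<open>The projection is the passage to cosets followed by the given isomorphism.  The operations of the
  quotient are unions over the elements of a coset; compatibility of the projection with them amounts
  to the fact that all the sets in such a union are equal.\<close>

lemma quotient_short_exact:
  assumes L: "cdg_module R L" and N: "cdg_submodule R N L" and T: "cdg_module R T"
    and iso: "cdg_isomorphic R (quotient_module L N) T"
  shows "\<exists>p. cdg_short_exact R (restrict_module L N) L T id_map p"
proof -
  interpret cdg_module R L by fact
  let ?Q = "quotient_module L N"
  obtain \<phi> where \<phi>: "cdg_hom R ?Q T \<phi>"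
    and bij: "\<And>n. bij_betw (\<phi> n) (carrier (mcomp ?Q n)) (carrier (mcomp T n))"
    using iso by (auto simp: cdg_isomorphic_def)
  have sub: "subgroup (N n) (mcomp L n)" for n using N by (simp add: cdg_submodule_def)
  have inN: "x \<in> N n \<Longrightarrow> x \<in> carrier (mcomp L n)" for x n
    using subgroup.subset[OF sub] by blast
  have actN: "r \<in> carrier (rcomp R m) \<Longrightarrow> x \<in> N n \<Longrightarrow> act L m n r x \<in> N (m + n)" for m n r x
    using N by (simp add: cdg_submodule_def)
  have diffN: "x \<in> N n \<Longrightarrow> mdiff L n x \<in> N (n + 1)" for n x
    using N by (simp add: cdg_submodule_def)
  define \<pi> where "\<pi> n x = N n #>\<^bsub>mcomp L n\<^esub> x" for n x
  have Q: "mcomp ?Q n = mcomp L n Mod N n" for n by (simp add: quotient_module_def)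
  have carrQ: "carrier (mcomp ?Q n) = \<pi> n ` carrier (mcomp L n)" for n
    by (simp add: Q carrier_FactGroup \<pi>_def)
  have nrm: "N n \<lhd> mcomp L n" for n
    using comm_group.subgroup_imp_normal[OF mcomp_comm_group sub] .
  have \<pi>hom: "\<pi> n \<in> hom (mcomp L n) (mcomp ?Q n)" for n
    using normal.r_coset_hom_Mod[OF nrm] by (simp add: Q \<pi>_def[abs_def])
  have \<pi>eq: "\<pi> n x = \<pi> n y" if "y \<in> \<pi> n x" "x \<in> carrier (mcomp L n)" for n x y
    using that group.repr_independence[OF mcomp_group _ _ sub] by (simp add: \<pi>_def)
  have self: "x \<in> \<pi> n x" if "x \<in> carrier (mcomp L n)" for n x
    using that group.rcos_self[OF mcomp_group _ sub] by (simp add: \<pi>_def)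
  have cosetE: "\<exists>h \<in> N n. y = h \<otimes>\<^bsub>mcomp L n\<^esub> x" if "y \<in> \<pi> n x" for n x y
    using that by (auto simp: \<pi>_def r_coset_def)
  have cosetI: "h \<otimes>\<^bsub>mcomp L n\<^esub> x \<in> \<pi> n x" if "h \<in> N n" for n x h
    using that by (auto simp: \<pi>_def r_coset_def)
  have \<pi>act: "act ?Q m n r (\<pi> n x) = \<pi> (m + n) (act L m n r x)"
    if rx: "r \<in> carrier (rcomp R m)" "x \<in> carrier (mcomp L n)" for m n r x
  proof -
    have const: "\<pi> (m + n) (act L m n r y) = \<pi> (m + n) (act L m n r x)" if y: "y \<in> \<pi> n x" for y
    proof (rule \<pi>eq[symmetric])
      obtain h where h: "h \<in> N n" "y = h \<otimes>\<^bsub>mcomp L n\<^esub> x" using cosetE[OF y] by blast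
      then show "act L m n r y \<in> \<pi> (m + n) (act L m n r x)"
        using rx inN actN by (auto simp: act_mult_right intro!: cosetI)
    qed (use rx in auto)
    have "act ?Q m n r (\<pi> n x) = (\<Union>y\<in>\<pi> n x. \<pi> (m + n) (act L m n r y))"
      by (simp add: quotient_module_def \<pi>_def)
    also have "\<dots> = (\<Union>y\<in>\<pi> n x. \<pi> (m + n) (act L m n r x))"
      by (intro SUP_cong refl const)
    finally show ?thesis using self[OF rx(2)] by auto
  qed
  have \<pi>diff: "mdiff ?Q n (\<pi> n x) = \<pi> (n + 1) (mdiff L n x)"
    if x: "x \<in> carrier (mcomp L n)" for n x
  proof -
    have const: "\<pi> (n + 1) (mdiff L n y) = \<pi> (n + 1) (mdiff L n x)" if y: "y \<in> \<pi> n x" for y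
    proof (rule \<pi>eq[symmetric])
      obtain h where h: "h \<in> N n" "y = h \<otimes>\<^bsub>mcomp L n\<^esub> x" using cosetE[OF y] by blast
      then show "mdiff L n y \<in> \<pi> (n + 1) (mdiff L n x)"
        using x inN diffN by (auto simp: mdiff_mult intro!: cosetI)
    qed (use x in auto)
    have "mdiff ?Q n (\<pi> n x) = (\<Union>y\<in>\<pi> n x. \<pi> (n + 1) (mdiff L n y))"
      by (simp add: quotient_module_def \<pi>_def)
    also have "\<dots> = (\<Union>y\<in>\<pi> n x. \<pi> (n + 1) (mdiff L n x))"
      by (intro SUP_cong refl const)
    finally show ?thesis using self[OF x] by auto
  qed
  have "cdg_hom R L ?Q \<pi>"
    using \<pi>hom \<pi>act \<pi>diff by (simp add: cdg_hom_def graded_hom_def)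
  then have p: "cdg_hom R L T (comp_map \<phi> \<pi>)" using cdg_hom_comp \<phi> by blast
  interpret p: cdg_morphism R L T "comp_map \<phi> \<pi>" by (intro cdg_morphismI L T p)
  have "cdg_short_exact R (restrict_module L N) L T id_map (comp_map \<phi> \<pi>)"
    unfolding cdg_short_exact_def
  proof (intro conjI allI L T p cdg_module_restrict_module[OF L N])
    show "cdg_hom R (restrict_module L N) L id_map"
      by (rule cdg_homI) (auto simp: id_map_def inN)
    fix n
    show "inj_on (id_map n) (carrier (mcomp (restrict_module L N) n))"
      by (simp add: id_map_def inj_on_def)
    show "comp_map \<phi> \<pi> n ` carrier (mcomp L n) = carrier (mcomp T n)"
      using bij[of n] unfolding bij_betw_def carrQ by (auto simp: comp_map_def image_comp)
    have "\<phi> n (\<pi> n x) = \<one>\<^bsub>mcomp T n\<^esub> \<longleftrightarrow> x \<in> N n" if x: "x \<in> carrier (mcomp L n)" for x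
    proof -
      have one: "\<phi> n (\<pi> n \<one>\<^bsub>mcomp L n\<^esub>) = \<one>\<^bsub>mcomp T n\<^esub>"
        using p.map_one[of n n] by (simp add: comp_map_def)
      have "\<pi> n \<one>\<^bsub>mcomp L n\<^esub> = N n"
        using group.coset_join2[OF mcomp_group _ sub subgroup.one_closed[OF sub]] by (simp add: \<pi>_def)
      moreover have "\<phi> n (\<pi> n x) = \<phi> n (\<pi> n \<one>\<^bsub>mcomp L n\<^esub>) \<longleftrightarrow> \<pi> n x = \<pi> n \<one>\<^bsub>mcomp L n\<^esub>"
        using bij[of n] x unfolding bij_betw_def carrQ by (intro inj_on_eq_iff) auto
      moreover have "\<pi> n x = N n \<longleftrightarrow> x \<in> N n"
        using group.coset_join1[OF mcomp_group _ x sub] group.coset_join2[OF mcomp_group x sub]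
        by (auto simp: \<pi>_def)
      ultimately show ?thesis using one by simp
    qed
    then show "id_map n ` carrier (mcomp (restrict_module L N) n) = kernel (mcomp L n) (mcomp T n) (comp_map \<phi> \<pi> n)"
      by (auto simp: kernel_def comp_map_def id_map_def inN image_def)
  qed
  then show ?thesis by blast
qed

section \<open>Induction along the filtration\<close>

lemma ord_cases:
  fixes i :: "'i::wellorder"
  obtains "i = ord_zero" | j where "j < i" "i = ord_succ j" | "ord_limit i"
proof -
  consider "i = ord_zero" | "ord_limit i" | j where "j < i" "\<not> ord_succ j < i"
    unfolding ord_limit_def by blast
  then show ?thesis
  proof cases
    case (3 j)
    have "ord_succ j \<le> i" unfolding ord_succ_def using 3(1) by (rule Least_le)
    with 3(2) have "i = ord_succ j" by simp
    then show ?thesis by (rule that(2)[OF 3(1)])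
  qed (fact that)+
qed

text \<open>The running maxima of an enumeration of \<open>{..<i}\<close>.\<close>

lemma ex_countable_cofinal:
  fixes i :: "'i::linorder"
  assumes "countable {..<i}" "{..<i} \<noteq> {}"
  obtains s :: "nat \<Rightarrow> 'i" where "\<And>k. s k < i" "\<And>k. s k \<le> s (Suc k)" "\<And>j. j < i \<Longrightarrow> \<exists>k. j \<le> s k"
proof -
  define g where "g = from_nat_into {..<i}"
  have g: "range g = {..<i}" unfolding g_def using assms by (simp add: range_from_nat_into)
  define s where "s k = Max (g ` {..k})" for k
  have "s k \<in> g ` {..k}" for k unfolding s_def by (rule Max_in) auto
  then have "s k < i" for k using g by blast
  moreover have "s k \<le> s (Suc k)" for k unfolding s_def by (rule Max_mono) auto
  moreover have "\<exists>k. j \<le> s k" if "j < i" for j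
  proof -
    obtain k where "j = g k" using g \<open>j < i\<close> by blast
    then have "j \<le> s k" unfolding s_def by (intro Max_ge) auto
    then show ?thesis ..
  qed
  ultimately show ?thesis using that by blast
qed

lemma cdg_submodule_restrict:
  assumes M: "cdg_module R M" and N: "cdg_submodule R N M" and N': "cdg_submodule R N' M"
    and le: "\<And>n. N n \<subseteq> N' n"
  shows "cdg_submodule R N (restrict_module M N')"
  using assms group.subgroup_incl[OF cdg_module.mcomp_group[OF M]]
  by (auto simp: cdg_submodule_def)

lemma restrict_restrict_module [simp]:
  "restrict_module (restrict_module M N') N = restrict_module M N"
  by (simp add: restrict_module_def)

lemma restrict_module_carrier:
  assumes "\<And>n. N n = carrier (mcomp M n)"
  shows "restrict_module M N = M"
  using assms by (simp add: restrict_module_def)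

text \<open>The zero object is the direct sum of the empty family.\<close>

lemma trivial_in_triangulated:
  fixes Z :: "('r, 'u) cdg_module"
  assumes "cdg_ring R" "closed_under_countable_sums R S" and Z: "cdg_module R Z"
    and triv: "\<And>n. carrier (mcomp Z n) = {\<one>\<^bsub>mcomp Z n\<^esub>}"
  shows "Z \<in> S"
proof -
  let ?D = "direct_sum ({} :: nat set) (\<lambda>i. undefined :: ('r, 'u) cdg_module)"
  have D: "cdg_module R ?D" by (rule cdg_module_direct_sum) (use assms in auto)
  have car: "carrier (mcomp ?D n) = {\<lambda>i. undefined}" for n
    unfolding direct_sum_simps by (subst carrier_sum_group) auto
  have mult: "x \<otimes>\<^bsub>mcomp ?D n\<^esub> y = (\<lambda>i. undefined)" for n x y
    by (simp add: restrict_def)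
  have "cdg_isomorphic R Z ?D"
    unfolding cdg_isomorphic_def
    by (rule exI[of _ "\<lambda>n x i. undefined"], intro conjI allI cdg_homI)
      (auto simp: triv car mult bij_betw_def simp del: direct_sum_simps(1))
  then have "hot_isomorphic R Z ?D" using Z D cdg_isomorphic_imp_hot_isomorphic by blast
  then show ?thesis using assms unfolding closed_under_countable_sums_def by blast
qed

text \<open>By transfinite induction on \<open>i\<close>.  The zero step is the empty direct sum.  At a successor, \<open>F i\<close> is an
  extension of an object of \<open>\<T>\<close> by the preceding step.  At a limit, countability of \<open>\<alpha>\<close> provides a
  cofinal sequence, and \<open>F i\<close> is the last term of the telescope sequence of the corresponding submodules.\<close>

lemma filtration_in_triangulated:
  fixes M :: "('r, 'u) cdg_module" and \<alpha> i :: "'i::wellorder"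
  assumes inf: "infinite (UNIV :: 'u set)"
    and M: "cdg_module R M" and F: "filtration R \<alpha> M F"
    and T: "\<forall>T\<in>\<T>. cdg_module R T"
    and quot: "\<forall>i<\<alpha>. \<exists>T\<in>\<T>.
                 cdg_isomorphic R (quotient_module (restrict_module M (F (ord_succ i))) (F i)) T"
    and count: "countable {..<\<alpha>}"
    and S: "full_triangulated_subcategory R S" and sums: "closed_under_countable_sums R S"
    and \<T>: "\<T> \<subseteq> S" and Tot: "totalizations R \<subseteq> S"
  shows "i \<le> \<alpha> \<Longrightarrow> restrict_module M (F i) \<in> S"
proof (induction i rule: less_induct)
  case (less i)
  have R: "cdg_ring R" using M by (simp add: cdg_module_def)
  have sub: "cdg_submodule R (F j) M" if "j \<le> \<alpha>" for j
    using F that by (simp add: filtration_def)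
  have mono: "F j n \<subseteq> F k n" if "j \<le> k" "k \<le> \<alpha>" for j k n
    using F that by (simp add: filtration_def)
  have mod: "cdg_module R (restrict_module M (F j))" if "j \<le> \<alpha>" for j
    by (rule cdg_module_restrict_module[OF M sub[OF that]])
  consider "i = ord_zero" | j where "j < i" "i = ord_succ j" | "ord_limit i" by (rule ord_cases)
  then show ?case
  proof cases
    case 1
    then have "F i n = {\<one>\<^bsub>mcomp M n\<^esub>}" for n using F by (simp add: filtration_def)
    then show ?thesis
      by (intro trivial_in_triangulated[OF R sums mod[OF less.prems]]) simp
  next
    case (2 j)
    then have j: "j < \<alpha>" "j \<le> \<alpha>" using less.prems by auto
    obtain T where T': "T \<in> \<T>" "cdg_isomorphic R (quotient_module (restrict_module M (F i)) (F j)) T"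
      using quot j(1) 2 by blast
    have "cdg_submodule R (F j) (restrict_module M (F i))"
      by (rule cdg_submodule_restrict[OF M sub[OF j(2)] sub[OF less.prems] mono]) (use 2 less.prems in auto)
    then obtain p where "cdg_short_exact R (restrict_module M (F j)) (restrict_module M (F i)) T id_map p"
      using quotient_short_exact[OF mod[OF less.prems] _ _ T'(2)] T T'(1) by auto
    then show ?thesis
      using short_exact_in_triangulated(2)[OF inf S Tot] less.IH[OF 2(1) j(2)] T'(1) \<T> by blast
  next
    case 3
    have ne: "{..<i} \<noteq> {}"
    proof -
      have "ord_zero \<noteq> i" "ord_zero \<le> i" using 3 by (auto simp: ord_limit_def ord_zero_def intro: Least_le)
      then have "ord_zero \<in> {..<i}" by simp
      then show ?thesis by blast
    qed
    have "countable {..<i}"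
      by (rule countable_subset[OF _ count]) (use less.prems in auto)
    then obtain s where s: "\<And>k. s k < i" "\<And>k. s k \<le> s (Suc k)" "\<And>j. j < i \<Longrightarrow> \<exists>k. j \<le> s k"
      using ex_countable_cofinal ne by blast
    have s\<alpha>: "s k \<le> \<alpha>" for k using s(1)[of k] less.prems by simp
    have "F i n = (\<Union>j\<in>{..<i}. F j n)" for n
      using F 3 less.prems by (simp add: filtration_def)
    also have "(\<Union>j\<in>{..<i}. F j n) = (\<Union>k. F (s k) n)" for n
    proof (intro equalityI subsetI)
      fix x assume "x \<in> (\<Union>j\<in>{..<i}. F j n)"
      then obtain j where "j < i" "x \<in> F j n" by blast
      then show "x \<in> (\<Union>k. F (s k) n)" using s(3)[of j] mono s\<alpha> by blast
    qed (use s(1) in blast)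
    finally have union: "F i n = (\<Union>k. F (s k) n)" for n .
    interpret exhausted_module R "restrict_module M (F i)" "\<lambda>k. F (s k)"
    proof (intro exhausted_module.intro exhausted_module_axioms.intro mod less.prems)
      show "cdg_submodule R (F (s k)) (restrict_module M (F i))" for k
        by (rule cdg_submodule_restrict[OF M sub[OF s\<alpha>] sub[OF less.prems] mono])
          (use s(1) less.prems in \<open>auto intro: less_imp_le\<close>)
      show "F (s k) n \<subseteq> F (s (Suc k)) n" for k n
        by (rule mono[OF s(2) s\<alpha>])
    qed (simp add: union)
    show ?thesis
      by (rule in_triangulated[OF inf S Tot sums]) (simp add: less.IH[OF s(1) s\<alpha>])
  qed
qed

theorem theorem4p17:
  fixes R :: "'r cdg_ring"
    and \<T> :: "('r, 'u) cdg_module set"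
    and \<alpha> :: "'i::wellorder"
  assumes "infinite (UNIV :: 'u set)"
    and "cdg_ring R"
    and "\<forall>T\<in>\<T>. cdg_module R T"
    and "countable {..<\<alpha>}"
  shows "Fil R \<alpha> \<T> \<subseteq> minimal_triangulated_countable_sums R (\<T> \<union> totalizations R)"
proof
  fix M assume "M \<in> Fil R \<alpha> \<T>"
  then obtain F where M: "cdg_module R M" and F: "filtration R \<alpha> M F"
    and quot: "\<forall>i<\<alpha>. \<exists>T\<in>\<T>.
                 cdg_isomorphic R (quotient_module (restrict_module M (F (ord_succ i))) (F i)) T"
    by (auto simp: Fil_def)
  have "restrict_module M (F \<alpha>) = M"
    by (rule restrict_module_carrier) (use F in \<open>simp add: filtration_def\<close>)
  then show "M \<in> minimal_triangulated_countable_sums R (\<T> \<union> totalizations R)"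
    using filtration_in_triangulated[OF assms(1) M F assms(3) quot assms(4) _ _ _ _ order_refl]
    by (auto simp: minimal_triangulated_countable_sums_def)
qed

end
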